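(* Let $A\in\mathbb{R}^{n\times n}$, $C\in\mathbb{R}^{q\times n}$, $F\in\mathbb{R}^{r\times n}$, and let a sampling sequence $\{t_i\}_{i=1}^k$ be given. The triple $(A,C,F)$ is sample-based functionally observable (for this sampling sequence) if and only if $$\operatorname{rank}\begin{pmatrix}O_{\mathrm s}(A,C)\\ O(A,F)\end{pmatrix}=\operatorname{rank}\big(O_{\mathrm s}(A,C)\big).$$ (The statement holds both in the continuous-time and in the discrete-time setting, with the corresponding sample-based observability matrix $O_{\mathrm s}$.)
   Context: System: $x^+=Ax(t)+Bu(t)$, $y(t)=Cx(t)+Du(t)$, $z(t)=Fx(t)$ with $A\in\mathbb{R}^{n\times n}$, $B\in\mathbb{R}^{n\times m}$, $C\in\mathbb{R}^{q\times n}$, $D\in\mathbb{R}^{q\times m}$, $F\in\mathbb{R}^{r\times n}$, where $x^+$ denotes $\dot x(t)$ for continuous-time systems and $x(t+1)$ for discrete-time systems. Observability matrix: for $M\in\mathbb{R}^{n\times n}$ and $N$ with $n$ columns, $O(M,N)$ is the matrix obtained by stacking $N, NM, NM^2,\dots,NM^{n-1}$ vertically. Sampling sequence: time instances $\{t_i\}_{i=1}^k$, $k\ge 1$, with $0\le t_1$ and $t_i<t_{i+1}$ for $i=1,\dots,k-1$ (real numbers in continuous time, integers in discrete time). Sample-based observability matrix: $O_{\mathrm s}(M,N)$ is the matrix obtained by stacking vertically $Ne^{Mt_1},\dots,Ne^{Mt_k}$ in the continuous-time case, and $NM^{t_1},\dots,NM^{t_k}$ in the discrete-time case. Observable subsystem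 of $(A,F)$ and the constant $\sigma$: let $p_F$ be the dimension of $\operatorname{null}(O(A,F))$. There is an invertible $P_{\mathrm{o,F}}\in\mathbb{R}^{n\times n}$ with $$P_{\mathrm{o,F}}^{-1}AP_{\mathrm{o,F}}=\begin{pmatrix}A_{\mathrm{ob,F}}&0\\ A_{21,\mathrm F}&A_{\overline{\mathrm{ob}},\mathrm F}\end{pmatrix},\qquad FP_{\mathrm{o,F}}=\begin{pmatrix}F_{\mathrm{ob}}&0\end{pmatrix},$$ where $(A_{\mathrm{ob,F}},F_{\mathrm{ob}})$ is observable of order $n-p_F$. Let $\nu$ be the observability index of $(A_{\mathrm{ob,F}},F_{\mathrm{ob}})$, i.e. the smallest integer such that the matrix obtained by stacking $F_{\mathrm{ob}},F_{\mathrm{ob}}A_{\mathrm{ob,F}},\dots,F_{\mathrm{ob}}A_{\mathrm{ob,F}}^{\nu-1}$ has rank $n-p_F$. Set $\sigma=0$ if the system is continuous-time and $\sigma=\nu-2$ if it is discrete-time. Sample-based functional observability: $(A,C,F)$ is sample-based functionally observable for the sampling sequence $\{t_i\}_{i=1}^k$ if there exists a finite time $\bar t>\sigma$ such that for any initial state $x_0$ and input $u(t)$, the value of $Fx(t)$, $0\le t\le\bar t$, can be uniquely reconstructed from the knowledge of the input trajectory on the interval $[0,\bar t]$ and the sampled outputs $y(t_i)$, $i=1,\dots,k$. (In discrete time, times are integers.) *)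

theory Defs
  imports
    "HOL-Library.Countable_Set"
    "HOL-Library.FuncSet"
    "Jordan_Normal_Form.DL_Rank"
    "Jordan_Normal_Form.Matrix_Kernel"
begin

subsection \<open>Rank, stacking, matrix exponential\<close>

definition mat_rank :: "real mat \<Rightarrow> nat" where
  "mat_rank M = vec_space.rank (dim_row M) M"

text \<open>The number of columns is an argument so that the empty stack is a \<open>0 \<times> nc\<close> matrix.\<close>

definition vstack :: "nat \<Rightarrow> real mat list \<Rightarrow> real mat" where
  "vstack nc Ms = foldr (@\<^sub>r) Ms (0\<^sub>m 0 nc)"

text \<open>
  The exponential series is summed entrywise, because the type of matrices of arbitrary
  dimension carries no topology.
\<close>

definition mat_exp :: "real mat \<Rightarrow> real mat" where
  "mat_exp M = mat (dim_row M) (dim_row M) (\<lambda>(i, j). \<Sum>k. (M ^\<^sub>m k) $$ (i, j) / fact k)"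

subsection \<open>Observability matrices\<close>

definition obs_stack :: "real mat \<Rightarrow> real mat \<Rightarrow> nat \<Rightarrow> real mat" where
  "obs_stack M N l = vstack (dim_row M) (map (\<lambda>i. N * M ^\<^sub>m i) [0..<l])"

definition obs_mat :: "real mat \<Rightarrow> real mat \<Rightarrow> real mat" where
  "obs_mat M N = obs_stack M N (dim_row M)"

definition observable :: "real mat \<Rightarrow> real mat \<Rightarrow> bool" where
  "observable M N \<longleftrightarrow> mat_rank (obs_mat M N) = dim_row M"

text \<open>A sampling sequence \<open>t\<^sub>1 < \<dots> < t\<^sub>k\<close> with \<open>k \<ge> 1\<close> is the list of its time instances.\<close>

definition sampling_sequence :: "'t :: {linorder, zero} list \<Rightarrow> bool" where
  "sampling_sequence ts \<longleftrightarrow> ts \<noteq> [] \<and> 0 \<le> hd ts \<and> sorted_wrt (<) ts"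

definition ct_sample_obs_mat :: "real mat \<Rightarrow> real mat \<Rightarrow> real list \<Rightarrow> real mat" where
  "ct_sample_obs_mat M N ts = vstack (dim_row M) (map (\<lambda>t. N * mat_exp (t \<cdot>\<^sub>m M)) ts)"

definition dt_sample_obs_mat :: "real mat \<Rightarrow> real mat \<Rightarrow> nat list \<Rightarrow> real mat" where
  "dt_sample_obs_mat M N ts = vstack (dim_row M) (map (\<lambda>t. N * M ^\<^sub>m t) ts)"

subsection \<open>Observable subsystem and the constant sigma\<close>

text \<open>
  Here \<open>Q\<close> is the inverse of \<open>P\<close>, and the four-block matrix without lower rows is the row
  block \<open>(Fob 0)\<close>.
\<close>

definition observable_subsystem ::
  "real mat \<Rightarrow> real mat \<Rightarrow> real mat \<Rightarrow> real mat \<Rightarrow> bool" where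
  "observable_subsystem A F Aob Fob \<longleftrightarrow>
    (let n = dim_row A; r = dim_row F; p = kernel_dim (obs_mat A F) in
      Aob \<in> carrier_mat (n - p) (n - p) \<and> Fob \<in> carrier_mat r (n - p) \<and>
      observable Aob Fob \<and>
      (\<exists>P Q A21 Aunob.
        P \<in> carrier_mat n n \<and> Q \<in> carrier_mat n n \<and> inverts_mat P Q \<and> inverts_mat Q P \<and>
        A21 \<in> carrier_mat p (n - p) \<and> Aunob \<in> carrier_mat p p \<and>
        Q * A * P = four_block_mat Aob (0\<^sub>m (n - p) p) A21 Aunob \<and>
        F * P = four_block_mat Fob (0\<^sub>m r p) (0\<^sub>m 0 (n - p)) (0\<^sub>m 0 p)))"

definition observability_index :: "real mat \<Rightarrow> real mat \<Rightarrow> nat" where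
  "observability_index M N = (LEAST l. mat_rank (obs_stack M N l) = dim_row M)"

text \<open>
  The observable subsystem exists, and it is unique up to a change of basis, which does not affect
  the observability index; the choice made here is therefore immaterial.
  In continuous time the constant is \<open>0\<close>.
\<close>

definition dt_sigma :: "real mat \<Rightarrow> real mat \<Rightarrow> int" where
  "dt_sigma A F = (SOME s. \<exists>Aob Fob. observable_subsystem A F Aob Fob \<and>
     s = int (observability_index Aob Fob) - 2)"

subsection \<open>Trajectories\<close>

text \<open>
  The state is continuous and satisfies the differential equation, read componentwise, at all times
  outside a countable set. The exceptional set admits inputs with jumps, such as piecewise
  continuous ones; for continuous inputs the solutions are the classical ones.
  At time \<open>0\<close> the derivative is one-sided.
\<close>

definition ct_trajectory ::
  "real mat \<Rightarrow> real mat \<Rightarrow> real vec \<Rightarrow> (real \<Rightarrow> real vec) \<Rightarrow> (real \<Rightarrow> real vec) \<Rightarrow> bool" where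
  "ct_trajectory A B x0 u x \<longleftrightarrow>
    x 0 = x0 \<and>
    (\<forall>t\<ge>0. x t \<in> carrier_vec (dim_row A) \<and> u t \<in> carrier_vec (dim_col B)) \<and>
    (\<forall>i<dim_row A. continuous_on {0..} (\<lambda>t. x t $ i)) \<and>
    (\<exists>E. countable E \<and> (\<forall>t\<in>{0..} - E. \<forall>i<dim_row A.
      ((\<lambda>s. x s $ i) has_real_derivative (A *\<^sub>v x t + B *\<^sub>v u t) $ i) (at t within {0..})))"

definition dt_trajectory ::
  "real mat \<Rightarrow> real mat \<Rightarrow> real vec \<Rightarrow> (nat \<Rightarrow> real vec) \<Rightarrow> (nat \<Rightarrow> real vec) \<Rightarrow> bool" where
  "dt_trajectory A B x0 u x \<longleftrightarrow>
    x 0 = x0 \<and>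
    (\<forall>t. x t \<in> carrier_vec (dim_row A) \<and> u t \<in> carrier_vec (dim_col B)) \<and>
    (\<forall>t. x (Suc t) = A *\<^sub>v x t + B *\<^sub>v u t)"

subsection \<open>Sample-based functional observability\<close>

text \<open>
  \<open>reconstructible traj n C D F ts tb\<close>: a single map \<open>R\<close> recovers \<open>F x(t)\<close> on \<open>[0, tb]\<close> from
  the input restricted to \<open>[0, tb]\<close> and the sampled outputs, whatever the initial state and input.
  The samples are not required to lie in \<open>[0, tb]\<close>.
\<close>

definition reconstructible ::
  "(real vec \<Rightarrow> ('t :: {linorder, zero} \<Rightarrow> real vec) \<Rightarrow> ('t \<Rightarrow> real vec) \<Rightarrow> bool) \<Rightarrow> nat \<Rightarrow>
   real mat \<Rightarrow> real mat \<Rightarrow> real mat \<Rightarrow> 't list \<Rightarrow> 't \<Rightarrow> bool" where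
  "reconstructible traj n C D F ts tb \<longleftrightarrow>
    (\<exists>R :: ('t \<Rightarrow> real vec) \<Rightarrow> real vec list \<Rightarrow> 't \<Rightarrow> real vec.
      \<forall>x0\<in>carrier_vec n. \<forall>u x. traj x0 u x \<longrightarrow>
        (\<forall>t\<in>{0..tb}.
          F *\<^sub>v x t = R (restrict u {0..tb}) (map (\<lambda>s. C *\<^sub>v x s + D *\<^sub>v u s) ts) t))"

definition ct_sb_functionally_observable ::
  "real mat \<Rightarrow> real mat \<Rightarrow> real mat \<Rightarrow> real mat \<Rightarrow> real mat \<Rightarrow> real list \<Rightarrow> bool" where
  "ct_sb_functionally_observable A B C D F ts \<longleftrightarrow>
    (\<exists>tb>0. reconstructible (ct_trajectory A B) (dim_row A) C D F ts tb)"

definition dt_sb_functionally_observable ::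
  "real mat \<Rightarrow> real mat \<Rightarrow> real mat \<Rightarrow> real mat \<Rightarrow> real mat \<Rightarrow> nat list \<Rightarrow> bool" where
  "dt_sb_functionally_observable A B C D F ts \<longleftrightarrow>
    (\<exists>tb. int tb > dt_sigma A F \<and> reconstructible (dt_trajectory A B) (dim_row A) C D F ts tb)"

end

(* The sampled outputs and the values F x(t) depend linearly on the initial state once the input is
   fixed, so reconstructibility means that every initial state e annihilated by the sample-based
   observability matrix has F x(t) = 0 along its free motion. This in turn means F A^k e = 0 for all
   k, i.e. e lies in the kernel of the observability matrix, and by rank-nullity the inclusion of
   kernels is the rank condition. The passage from F x(t) = 0 on [0, tb] to all powers uses the
   power series of the matrix exponential in continuous time, and in discrete time the observable
   decomposition, which shows that sigma + 2 powers suffice. *)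

theory Submission
  imports Defs "HOL-Analysis.Continuum_Not_Denumerable"
begin

text \<open>Three obstacles shape the proof. In discrete time \<open>dt_sigma\<close> is picked by
  \<open>SOME\<close> and says nothing until an observable subsystem is known to exist. One is
  therefore constructed, from a basis adapted to the kernel of the observability matrix; Gaussian
  elimination of the transpose supplies it. The shift by 2 in sigma is exact bookkeeping: an integer
  above \<nu> - 2 is at least \<nu> - 1, so the horizon covers the \<nu> instants 0, ..., \<nu> - 1.
  In continuous time the equation may fail on a countable set, so uniqueness of solutions rests on
  the fact that a continuous function with zero derivative off a countable set is constant;
  statements on the exponential are reduced to scalar power series. In both settings samples may lie
  beyond the horizon, where the input is unknown. For necessity this is harmless, since two motions
  under the zero input are compared; for sufficiency the horizon may be chosen, and it is placed
  beyond all samples.\<close>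

subsection \<open>Rank and kernels\<close>

text \<open>Rank-nullity for multiplication by \<open>M\<close>: the image is the column space,
  whose dimension is the rank by definition.\<close>

lemma rank_plus_kernel_dim:
  fixes M :: "'a :: field mat"
  assumes M: "M \<in> carrier_mat nr nc"
  shows "vec_space.rank nr M + kernel_dim M = nc"
proof -
  interpret C: vec_space "TYPE('a)" nc .
  interpret R: vec_space "TYPE('a)" nr .
  have hom: "(\<lambda>v. M *\<^sub>v v) \<in> LinearCombinations.module_hom class_ring C.V R.V"
    unfolding LinearCombinations.module_hom_def
    using mult_add_distrib_mat_vec[OF M] mult_mat_vec[OF M] mult_mat_vec_carrier[OF M]
    by (simp add: module_vec_simps)
  interpret T: linear_map class_ring C.V R.V "\<lambda>v. M *\<^sub>v v"
    by (intro linear_map.intro mod_hom.intro mod_hom_axioms.intro hom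
        C.vectorspace_axioms R.vectorspace_axioms C.module_axioms R.module_axioms)
  have "T.im = R.col_space M"
    using M unfolding T.im_def R.col_space_eq[OF M] by (auto simp: module_vec_simps)
  moreover have "T.ker = mat_kernel M"
    using M unfolding T.ker_def mat_kernel[OF M] by (auto simp: module_vec_simps)
  moreover have "vectorspace.dim class_ring (R.vs (R.col_space M)) = R.rank M"
    unfolding R.rank_def R.col_space_def ..
  moreover have "vectorspace.dim class_ring (C.vs (mat_kernel M)) = kernel_dim M"
    unfolding kernel_dim_def carrier_matD(2)[OF M] ..
  ultimately show ?thesis
    using T.rank_nullity[OF C.fin_dim] C.dim_is_n by metis
qed

text \<open>A basis of the smaller kernel stays independent in the larger one, because both inherit
  their linear structure from the ambient space; with equal dimensions it is a basis there as well.
  The equality case later turns coincidences of dimensions into equalities of kernels.\<close>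

lemma kernel_dim_mono:
  fixes X Y :: "'a :: field mat"
  assumes X: "X \<in> carrier_mat nx nc" and Y: "Y \<in> carrier_mat ny nc"
    and sub: "mat_kernel X \<subseteq> mat_kernel Y"
  shows "kernel_dim X \<le> kernel_dim Y"
    and "kernel_dim X = kernel_dim Y \<Longrightarrow> mat_kernel X = mat_kernel Y"
proof -
  interpret X: kernel nx nc X by (unfold_locales, rule X)
  interpret Y: kernel ny nc Y by (unfold_locales, rule Y)
  obtain b where b: "finite b" "X.basis b" using kernel_basis_exists[OF X] by auto
  obtain c where c: "finite c" "Y.basis c" using kernel_basis_exists[OF Y] by auto
  have bX: "b \<subseteq> mat_kernel X" and spanb: "X.span b = mat_kernel X"
    using b(2) unfolding X.Ker.basis_def by auto
  have bY: "b \<subseteq> mat_kernel Y" using bX sub by auto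
  have cY: "c \<subseteq> mat_kernel Y" and genc: "Y.span c = mat_kernel Y"
    using c(2) unfolding Y.Ker.basis_def by auto
  have li: "\<not> Y.lin_dep b"
    using b(2) X.lindep_same[OF bX] Y.lindep_same[OF bY] unfolding X.Ker.basis_def by auto
  have fd: "Y.Ker.fin_dim" unfolding Y.Ker.fin_dim_def using c cY genc by auto
  have dimb: "kernel_dim X = card b" using X.Ker.dim_basis[OF b] X.kernel_dim by simp
  show "kernel_dim X \<le> kernel_dim Y"
    using Y.Ker.li_le_dim(2)[OF fd _ li] bY dimb by simp
  assume "kernel_dim X = kernel_dim Y"
  then have "Y.basis b"
    using Y.Ker.dim_li_is_basis[OF fd b(1) _ li] bY dimb by simp
  then have "mat_kernel Y = Y.span b" unfolding Y.Ker.basis_def by auto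
  also have "\<dots> = mat_kernel X"
    using X.span_same[OF bX] Y.span_same[OF bY] spanb by simp
  finally show "mat_kernel X = mat_kernel Y" by simp
qed

lemma kernel_dim_cong:
  fixes X Y :: "'a :: field mat"
  assumes "X \<in> carrier_mat nx nc" "Y \<in> carrier_mat ny nc" "mat_kernel X = mat_kernel Y"
  shows "kernel_dim X = kernel_dim Y"
  using kernel_dim_mono(1)[of X nx nc Y ny] kernel_dim_mono(1)[of Y ny nc X nx] assms by simp

lemma kernel_dim_le:
  fixes X :: "'a :: field mat"
  assumes "X \<in> carrier_mat nx nc"
  shows "kernel_dim X \<le> nc"
  using rank_plus_kernel_dim[OF assms] by simp

lemma mat_kernel_append_rows:
  fixes M N :: "'a :: field mat"
  assumes M: "M \<in> carrier_mat a nc" and N: "N \<in> carrier_mat b nc"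
  shows "mat_kernel (M @\<^sub>r N) = mat_kernel M \<inter> mat_kernel N"
proof -
  have 0: "0\<^sub>v (a + b) = 0\<^sub>v a @\<^sub>v (0\<^sub>v b :: 'a vec)"
    by (rule eq_vecI) (auto simp: append_vec_def)
  have "(M @\<^sub>r N) *\<^sub>v v = 0\<^sub>v (a + b) \<longleftrightarrow> M *\<^sub>v v = 0\<^sub>v a \<and> N *\<^sub>v v = 0\<^sub>v b"
    if "v \<in> carrier_vec nc" for v
  proof -
    have Mv: "M *\<^sub>v v \<in> carrier_vec a" using M by (rule mult_mat_vec_carrier) (rule that)
    show ?thesis
      using append_vec_eq[OF Mv, of "0\<^sub>v a" "N *\<^sub>v v" "0\<^sub>v b"] mat_mult_append[OF M N that] 0 by simp
  qed
  then show ?thesis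
    unfolding mat_kernel[OF carrier_append_rows[OF M N]] mat_kernel[OF M] mat_kernel[OF N]
    by blast
qed

text \<open>Stacking intersects kernels and keeps the number of columns. Equal ranks thus mean equal
  kernel dimensions, which for nested kernels forces equality.\<close>

lemma mat_rank_append_rows_eq_iff:
  assumes M: "M \<in> carrier_mat a nc" and N: "N \<in> carrier_mat b nc"
  shows "mat_rank (M @\<^sub>r N) = mat_rank M \<longleftrightarrow> mat_kernel M \<subseteq> mat_kernel N"
proof -
  have MN: "M @\<^sub>r N \<in> carrier_mat (a + b) nc" using M N by auto
  have "mat_rank M + kernel_dim M = nc" "mat_rank (M @\<^sub>r N) + kernel_dim (M @\<^sub>r N) = nc"
    using rank_plus_kernel_dim[OF M] rank_plus_kernel_dim[OF MN]
    unfolding mat_rank_def carrier_matD(1)[OF M] carrier_matD(1)[OF MN] .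
  then have "mat_rank (M @\<^sub>r N) = mat_rank M \<longleftrightarrow> kernel_dim (M @\<^sub>r N) = kernel_dim M"
    by linarith
  also have "\<dots> \<longleftrightarrow> mat_kernel (M @\<^sub>r N) = mat_kernel M"
    using kernel_dim_mono(2)[OF MN M] kernel_dim_cong[OF MN M] mat_kernel_append_rows[OF M N]
    by blast
  also have "\<dots> \<longleftrightarrow> mat_kernel M \<subseteq> mat_kernel N"
    unfolding mat_kernel_append_rows[OF M N] by auto
  finally show ?thesis .
qed

lemma mat_rank_full_iff:
  assumes M: "M \<in> carrier_mat nr nc"
  shows "mat_rank M = nc \<longleftrightarrow> mat_kernel M = {0\<^sub>v nc}"
proof -
  \<comment> \<open>The identity matrix is the reference whose kernel is trivial and of dimension 0,
    so that the equality case of \<open>kernel_dim_mono\<close> applies.\<close>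
  have one: "mat_kernel (1\<^sub>m nc :: real mat) = {0\<^sub>v nc}"
    by (auto simp: mat_kernel_def)
  have "kernel_dim (1\<^sub>m nc :: real mat) = 0"
    by (simp add: kernel_dim_def kernel_one_mat)
  moreover have "{0\<^sub>v nc} \<subseteq> mat_kernel M"
    using M by (auto simp: mat_kernel_def)
  ultimately have "kernel_dim M = 0 \<longleftrightarrow> mat_kernel M = {0\<^sub>v nc}"
    using kernel_dim_mono(2)[OF one_carrier_mat M] kernel_dim_cong[OF M one_carrier_mat] one
    by metis
  moreover have "mat_rank M + kernel_dim M = nc"
    using rank_plus_kernel_dim[OF M] unfolding mat_rank_def carrier_matD(1)[OF M] .
  then have "mat_rank M = nc \<longleftrightarrow> kernel_dim M = 0" by linarith
  ultimately show ?thesis by (rule trans[rotated])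
qed

section \<open>Kernels of vertical stacks\<close>

lemma vstack_Cons: "vstack nc (M # Ms) = M @\<^sub>r vstack nc Ms"
  unfolding vstack_def foldr.simps o_apply ..

lemma vstack_carrier:
  assumes "\<And>M. M \<in> set Ms \<Longrightarrow> dim_col M = nc"
  shows "vstack nc Ms \<in> carrier_mat (sum_list (map dim_row Ms)) nc"
  using assms
proof (induction Ms)
  case (Cons M Ms)
  have "M \<in> carrier_mat (dim_row M) nc" by (intro carrier_matI refl Cons.prems list.set_intros(1))
  then have "M @\<^sub>r vstack nc Ms \<in> carrier_mat (dim_row M + sum_list (map dim_row Ms)) nc"
    by (rule carrier_append_rows) (rule Cons.IH, rule Cons.prems, simp)
  then show ?case unfolding vstack_Cons by simp
qed (simp add: vstack_def)

lemma mat_kernel_vstack: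
  assumes "\<And>M. M \<in> set Ms \<Longrightarrow> dim_col M = nc"
  shows "mat_kernel (vstack nc Ms) = {x \<in> carrier_vec nc. \<forall>M\<in>set Ms. x \<in> mat_kernel M}"
  using assms
proof (induction Ms)
  case Nil
  show ?case by (simp add: vstack_def mat_kernel_def vec_eq_iff)
next
  case (Cons M Ms)
  have M: "M \<in> carrier_mat (dim_row M) nc" by (intro carrier_matI refl Cons.prems list.set_intros(1))
  have *: "\<And>N. N \<in> set Ms \<Longrightarrow> dim_col N = nc" by (intro Cons.prems list.set_intros(2))
  have "mat_kernel (vstack nc (M # Ms)) = mat_kernel M \<inter> mat_kernel (vstack nc Ms)"
    unfolding vstack_Cons by (rule mat_kernel_append_rows[OF M vstack_carrier[OF *]])
  also have "mat_kernel (vstack nc Ms) = {x \<in> carrier_vec nc. \<forall>M\<in>set Ms. x \<in> mat_kernel M}"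
    by (rule Cons.IH[OF *])
  finally show ?case using mat_kernel_carrier[OF M] by auto
qed

subsection \<open>Kernels of observability matrices\<close>

lemma vstack_map_carrier:
  assumes G: "\<And>t. t \<in> set ts \<Longrightarrow> G t \<in> carrier_mat r n"
  shows "vstack n (map G ts) \<in> carrier_mat (sum_list (map (dim_row \<circ> G) ts)) n"
proof -
  have "dim_col M = n" if "M \<in> set (map G ts)" for M
    using that by (auto simp: carrier_matD(2)[OF G])
  then show ?thesis using vstack_carrier[of "map G ts" n] by (simp only: map_map)
qed

lemma mat_kernel_vstack_map:
  assumes G: "\<And>t. t \<in> set ts \<Longrightarrow> G t \<in> carrier_mat r n"
  shows "mat_kernel (vstack n (map G ts)) =
    {x \<in> carrier_vec n. \<forall>t\<in>set ts. G t *\<^sub>v x = 0\<^sub>v r}"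
proof -
  have "dim_col M = n" if "M \<in> set (map G ts)" for M
    using that by (auto simp: carrier_matD(2)[OF G])
  then have "mat_kernel (vstack n (map G ts)) =
      {x \<in> carrier_vec n. \<forall>t\<in>set ts. x \<in> mat_kernel (G t)}"
    using mat_kernel_vstack[of "map G ts" n] by (simp only: set_map ball_simps)
  then show ?thesis using mat_kernel[OF G] by auto
qed

text \<open>The induction step of several later computations: the last factor of the power becomes
  one step of the free motion.\<close>

lemma mult_pow_Suc_mat_vec:
  fixes A F :: "'a :: comm_semiring_1 mat"
  assumes A: "A \<in> carrier_mat n n" and F: "F \<in> carrier_mat r n" and x: "x \<in> carrier_vec n"
  shows "(F * A ^\<^sub>m Suc k) *\<^sub>v x = (F * A ^\<^sub>m k) *\<^sub>v (A *\<^sub>v x)"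
proof -
  have P: "A ^\<^sub>m k \<in> carrier_mat n n" using A by simp
  have "F * A ^\<^sub>m Suc k = (F * A ^\<^sub>m k) * A"
    by (simp add: assoc_mult_mat[OF F P A])
  then show ?thesis
    using assoc_mult_mat_vec[OF mult_carrier_mat[OF F P] A x] by (simp only:)
qed

lemma obs_stack_carrier:
  assumes A: "A \<in> carrier_mat n n" and F: "F \<in> carrier_mat r n"
  shows "obs_stack A F l \<in> carrier_mat (dim_row (obs_stack A F l)) n"
  unfolding obs_stack_def carrier_matD(1)[OF A]
  by (rule carrier_matI[OF refl], rule carrier_matD(2), rule vstack_map_carrier)
    (rule mult_carrier_mat[OF F pow_carrier_mat[OF A]])

lemma mat_kernel_obs_stack:
  assumes A: "A \<in> carrier_mat n n" and F: "F \<in> carrier_mat r n"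
  shows "mat_kernel (obs_stack A F l) =
    {x \<in> carrier_vec n. \<forall>i<l. (F * A ^\<^sub>m i) *\<^sub>v x = 0\<^sub>v r}"
proof -
  have "mat_kernel (obs_stack A F l) =
      {x \<in> carrier_vec n. \<forall>i\<in>set [0..<l]. (F * A ^\<^sub>m i) *\<^sub>v x = 0\<^sub>v r}"
    unfolding obs_stack_def carrier_matD(1)[OF A]
    by (rule mat_kernel_vstack_map) (rule mult_carrier_mat[OF F pow_carrier_mat[OF A]])
  then show ?thesis by (simp only: set_upt Ball_def atLeastLessThan_iff le0 simp_thms)
qed

text \<open>Instead of the Cayley-Hamilton theorem: the kernels of the stacks decrease, so by dimension two
  consecutive ones among the first \<open>n + 2\<close> coincide, and then that kernel is \<open>A\<close>-invariant.\<close>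

lemma mat_kernel_obs_mat:
  assumes A: "A \<in> carrier_mat n n" and F: "F \<in> carrier_mat r n"
  shows "mat_kernel (obs_mat A F) = {x \<in> carrier_vec n. \<forall>k. (F * A ^\<^sub>m k) *\<^sub>v x = 0\<^sub>v r}"
proof -
  let ?V = "\<lambda>l. mat_kernel (obs_stack A F l)"
  let ?d = "\<lambda>l. kernel_dim (obs_stack A F l)"
  note V = mat_kernel_obs_stack[OF A F]
  note C = obs_stack_carrier[OF A F]
  have "\<exists>l\<le>n. ?V (Suc l) = ?V l"
  proof (rule ccontr)
    assume *: "\<not> ?thesis"
    \<comment> \<open>Each strict inclusion costs at least one dimension, and only \<open>n\<close>
      are available; at \<open>Suc n\<close> the budget is exceeded.\<close>
    have "l \<le> Suc n \<Longrightarrow> ?d l + l \<le> n" for l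
    proof (induction l)
      case 0
      show ?case using kernel_dim_le[OF C] by simp
    next
      case (Suc l)
      have sub: "?V (Suc l) \<subseteq> ?V l" unfolding V by auto
      have "?V (Suc l) \<noteq> ?V l" using * Suc.prems by auto
      then have "?d (Suc l) \<noteq> ?d l" using kernel_dim_mono(2)[OF C C sub] by blast
      moreover have "?d (Suc l) \<le> ?d l" using kernel_dim_mono(1)[OF C C sub] .
      moreover have "?d l + l \<le> n" using Suc by simp
      ultimately show ?case by linarith
    qed
    from this[of "Suc n"] show False by simp
  qed
  then obtain l where l: "l \<le> n" "?V (Suc l) = ?V l" by blast
  have "(F * A ^\<^sub>m k) *\<^sub>v x = 0\<^sub>v r" if "x \<in> ?V l" for k x
    using that
  proof (induction k arbitrary: x)
    case 0
    \<comment> \<open>For \<open>l = 0\<close> the set \<open>?V l\<close> is the whole space and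
      says nothing about the power 0, while \<open>?V (Suc l)\<close> does.\<close>
    then have "x \<in> ?V (Suc l)" using l by simp
    then show ?case unfolding V by blast
  next
    case (Suc k)
    have x: "x \<in> carrier_vec n" using Suc.prems unfolding V by blast
    \<comment> \<open>Applying \<open>A\<close> to \<open>x\<close> uses up one of the
      \<open>Suc l\<close> conditions; the \<open>l\<close> that remain lead back to the same
      kernel, which is the invariance.\<close>
    have "(F * A ^\<^sub>m i) *\<^sub>v (A *\<^sub>v x) = 0\<^sub>v r" if "i < l" for i
    proof -
      have "x \<in> ?V (Suc l)" using Suc.prems l by simp
      then have "(F * A ^\<^sub>m Suc i) *\<^sub>v x = 0\<^sub>v r" unfolding V using that Suc_mono by blast
      then show ?thesis unfolding mult_pow_Suc_mat_vec[OF A F x] .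
    qed
    then have "A *\<^sub>v x \<in> ?V l" unfolding V using A x by auto
    then show ?case unfolding mult_pow_Suc_mat_vec[OF A F x] by (rule Suc.IH)
  qed
  \<comment> \<open>Here \<open>l \<le> n\<close> enters: the \<open>n\<close> blocks of the
    observability matrix include those of the stack where the kernels become stationary.\<close>
  moreover have "?V n \<subseteq> ?V l" unfolding V using l(1) by auto
  moreover have "obs_mat A F = obs_stack A F n" using A by (simp add: obs_mat_def)
  moreover have "?V n = {x \<in> carrier_vec n. \<forall>i<n. (F * A ^\<^sub>m i) *\<^sub>v x = 0\<^sub>v r}"
    by (rule V)
  ultimately show ?thesis by (simp only:) blast
qed

section \<open>Bases adapted to a kernel, by Gaussian elimination\<close>

lemma pivot_fun_transpose_kernel:
  fixes E :: "'a :: field mat"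
  assumes E: "E \<in> carrier_mat n nr" and f: "pivot_fun E f nr"
  obtains k where "k \<le> n"
    and "\<And>z. z \<in> carrier_vec n \<Longrightarrow> E\<^sup>T *\<^sub>v z = 0\<^sub>v nr \<longleftrightarrow> (\<forall>i<k. z $ i = 0)"
proof -
  have dE: "dim_row E = n" using E by auto
  note piv = pivot_funD[OF dE f]
  \<comment> \<open>The value \<open>f i = nr\<close> marks a zero row, so \<open>k\<close> counts
    the nonzero rows; the alternative \<open>n \<le> i\<close> covers the absence of zero
    rows.\<close>
  define k where "k = (LEAST i. n \<le> i \<or> f i = nr)"
  have k: "n \<le> k \<or> f k = nr" unfolding k_def by (rule LeastI[of _ n]) simp
  have kn: "k \<le> n" unfolding k_def by (rule Least_le) simp
  have lt: "i < n \<and> f i < nr" if "i < k" for i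
    using not_less_Least[OF that[unfolded k_def]] piv(1)[of i] by force
  have ge: "f i = nr" if "k \<le> i" "i < n" for i
    using that
  proof (induction i rule: dec_induct)
    case base
    then show ?case using k by auto
  next
    case (step i)
    then have "f i = nr" by simp
    with piv(1)[of "Suc i"] piv(3)[of i] step show ?case by auto
  qed
  have "E\<^sup>T *\<^sub>v z = 0\<^sub>v nr \<longleftrightarrow> (\<forall>i<k. z $ i = 0)" if z: "z \<in> carrier_vec n" for z
  proof -
    have sum: "(E\<^sup>T *\<^sub>v z) $ j = (\<Sum>i<n. E $$ (i, j) * z $ i)" if "j < nr" for j
      using that E z by (simp add: scalar_prod_def atLeast0LessThan)
    show ?thesis
    proof
      assume 0: "E\<^sup>T *\<^sub>v z = 0\<^sub>v nr"
      show "\<forall>i<k. z $ i = 0"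
      proof (intro allI impI)
        fix i assume "i < k"
        then have i: "i < n" "f i < nr" using lt by auto
        \<comment> \<open>Column \<open>f i\<close> of \<open>E\<close> has the pivot 1 in row
          \<open>i\<close> and zeros elsewhere, so this coordinate of the product is
          \<open>z $ i\<close>.\<close>
        have "0 = (\<Sum>i'<n. E $$ (i', f i) * z $ i')" using sum[OF i(2)] 0 i(2) by simp
        also have "\<dots> = (\<Sum>i'<n. if i' = i then z $ i else 0)"
          by (rule sum.cong) (use piv(4,5) i in auto)
        finally show "z $ i = 0" using i(1) by simp
      qed
    next
      assume 0: "\<forall>i<k. z $ i = 0"
      show "E\<^sup>T *\<^sub>v z = 0\<^sub>v nr"
      proof (rule eq_vecI)
        fix j assume "j < dim_vec (0\<^sub>v nr :: 'a vec)"
        then have j: "j < nr" by simp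
        \<comment> \<open>Rows from \<open>k\<close> on vanish, and the earlier ones meet a zero of
          \<open>z\<close>.\<close>
        have "E $$ (i, j) * z $ i = 0" if "i < n" for i
          using 0 piv(2)[of i j] ge[of i] that j by (cases "i < k") auto
        then show "(E\<^sup>T *\<^sub>v z) $ j = 0\<^sub>v nr $ j" using j unfolding sum[OF j] by (simp add: sum.neutral)
      qed (use E in simp)
    qed
  qed
  then show thesis using that kn by blast
qed

text \<open>The dimension depends only on the kernel, so \<open>M\<close> may be replaced by the
  diagonal projection \<open>J\<close> with the same kernel. \<open>J\<close> is already in row
  echelon form, where the kernel dimension is read off from the number of nonzero rows.\<close>

lemma kernel_dim_coordinate_subspace:
  fixes M :: "'a :: field mat"
  assumes M: "M \<in> carrier_mat nr n" and k: "k \<le> n"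
    and ker: "\<And>z. z \<in> carrier_vec n \<Longrightarrow> M *\<^sub>v z = 0\<^sub>v nr \<longleftrightarrow> (\<forall>i<k. z $ i = 0)"
  shows "kernel_dim M = n - k"
proof -
  define J :: "'a mat" where "J = mat n n (\<lambda>(i, j). if i = j \<and> i < k then 1 else 0)"
  have J: "J \<in> carrier_mat n n" by (simp add: J_def)
  have row: "row J i = (if i < k then unit_vec n i else 0\<^sub>v n)" if "i < n" for i
    using that by (intro eq_vecI) (auto simp: J_def)
  have "J *\<^sub>v z = 0\<^sub>v n \<longleftrightarrow> (\<forall>i<k. z $ i = 0)" if z: "z \<in> carrier_vec n" for z
  proof -
    have "(J *\<^sub>v z) $ i = (if i < k then z $ i else 0)" if "i < n" for i
      using that z J row[OF that] by simp
    then show ?thesis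
      unfolding vec_eq_iff using J k by simp
  qed
  then have "mat_kernel J = mat_kernel M"
    unfolding mat_kernel[OF J] mat_kernel[OF M] using ker by auto
  then have "kernel_dim M = kernel_dim J" using kernel_dim_cong[OF J M] by simp
  also have "\<dots> = n - card {i. i < n \<and> row J i \<noteq> 0\<^sub>v n}"
  proof -
    have "pivot_fun J (\<lambda>i. if i < k then i else n) n"
      by (rule pivot_funI) (use k in \<open>auto simp: J_def split: if_splits\<close>)
    then have "row_echelon_form J" unfolding row_echelon_form_def using J by auto
    from find_base_vectors(6)[OF this J] show ?thesis using J by (simp add: kernel_dim_def)
  qed
  also have "{i. i < n \<and> row J i \<noteq> 0\<^sub>v n} = {..<k}"
  proof -
    have "unit_vec n i \<noteq> (0\<^sub>v n :: 'a vec)" if "i < n" for i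
      using that by (metis index_unit_vec(1) index_zero_vec(1) one_neq_zero)
    then show ?thesis using row k by (auto split: if_splits)
  qed
  finally show ?thesis by simp
qed

text \<open>Row reduction of the transpose is column reduction of \<open>M\<close>: from
  \<open>E = L * M\<^sup>T\<close> follows \<open>M * L\<^sup>T = E\<^sup>T\<close>. The last
  \<open>kernel_dim M\<close> columns of \<open>P = L\<^sup>T\<close> therefore span the
  kernel.\<close>

lemma kernel_adapted_basis:
  fixes M :: "'a :: field mat"
  assumes M: "M \<in> carrier_mat nr n"
  obtains P Q where "P \<in> carrier_mat n n" "Q \<in> carrier_mat n n"
    "P * Q = 1\<^sub>m n" "Q * P = 1\<^sub>m n"
    "\<And>z. z \<in> carrier_vec n \<Longrightarrow>
      M *\<^sub>v (P *\<^sub>v z) = 0\<^sub>v nr \<longleftrightarrow> (\<forall>i<n - kernel_dim M. z $ i = 0)"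
proof -
  have MT: "M\<^sup>T \<in> carrier_mat n nr" using M by simp
  define E where "E = gauss_jordan_single M\<^sup>T"
  note gj = gauss_jordan_single[OF MT E_def[symmetric]]
  obtain L R where E: "E = L * M\<^sup>T" and LR: "L \<in> carrier_mat n n" "R \<in> carrier_mat n n"
    "L * R = 1\<^sub>m n" "R * L = 1\<^sub>m n" using gj(4) by blast
  obtain f where "pivot_fun E f nr"
    using gj(2,3) unfolding row_echelon_form_def by auto
  from pivot_fun_transpose_kernel[OF gj(2) this] obtain k where k: "k \<le> n"
    and ker: "\<And>z. z \<in> carrier_vec n \<Longrightarrow> E\<^sup>T *\<^sub>v z = 0\<^sub>v nr \<longleftrightarrow> (\<forall>i<k. z $ i = 0)" by blast
  define P where "P = L\<^sup>T"
  define Q where "Q = R\<^sup>T"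
  have PQ: "P \<in> carrier_mat n n" "Q \<in> carrier_mat n n" using LR by (simp_all add: P_def Q_def)
  have PQ1: "P * Q = 1\<^sub>m n" "Q * P = 1\<^sub>m n"
    unfolding P_def Q_def transpose_mult[OF LR(2,1), symmetric] transpose_mult[OF LR(1,2), symmetric]
    using LR by simp_all
  have ET: "E\<^sup>T = M * P" unfolding E P_def using transpose_mult[OF LR(1) MT] by simp
  have MP: "M * P \<in> carrier_mat nr n" using M PQ by simp
  have "kernel_dim (M * P) = n - k"
    by (rule kernel_dim_coordinate_subspace[OF MP k ker[unfolded ET]])
  moreover have "kernel_dim (M * P) = kernel_dim M"
    using mat_kernel_dim_mult_eq_right[OF M PQ PQ1(1)] M PQ by (simp add: kernel_dim_def)
  ultimately have "n - kernel_dim M = k" using k by simp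
  then have "M *\<^sub>v (P *\<^sub>v z) = 0\<^sub>v nr \<longleftrightarrow> (\<forall>i<n - kernel_dim M. z $ i = 0)"
    if "z \<in> carrier_vec n" for z
    using ker[OF that, unfolded ET] assoc_mult_mat_vec[OF M PQ(1) that] by simp
  then show thesis using that PQ PQ1 by blast
qed

subsection \<open>The observable subsystem\<close>

lemma mult_mat_zero_vec:
  "M \<in> carrier_mat nr nc \<Longrightarrow> M *\<^sub>v 0\<^sub>v nc = (0\<^sub>v nr :: 'a :: semiring_0 vec)"
  by (rule eq_vecI) (auto simp: scalar_prod_def)

lemma zero_mat_mult_vec:
  "v \<in> carrier_vec nc \<Longrightarrow> 0\<^sub>m nr nc *\<^sub>v v = (0\<^sub>v nr :: 'a :: semiring_0 vec)"
  by (rule eq_vecI) (auto simp: scalar_prod_def)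

lemma mult_mat_unit_vec:
  fixes M :: "'a :: semiring_1 mat"
  assumes M: "M \<in> carrier_mat nr nc" and j: "j < nc"
  shows "M *\<^sub>v unit_vec nc j = col M j"
  by (rule eq_vecI) (use M j in auto)

text \<open>In the coordinates \<open>z1\<close>, \<open>z2\<close> the first block evolves by
  \<open>Aob\<close> alone and the output reads only that block, so \<open>z2\<close> never reaches
  the output.\<close>

lemma block_triangular_output:
  fixes A F :: "'a :: field mat"
  assumes A: "A \<in> carrier_mat n n" and F: "F \<in> carrier_mat r n"
    and P: "P \<in> carrier_mat n n" and Q: "Q \<in> carrier_mat n n" and PQ: "P * Q = 1\<^sub>m n"
    and n: "n = d + p"
    and Aob: "Aob \<in> carrier_mat d d" and A21: "A21 \<in> carrier_mat p d"
    and Aun: "Aun \<in> carrier_mat p p" and Fob: "Fob \<in> carrier_mat r d"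
    and QAP: "Q * A * P = four_block_mat Aob (0\<^sub>m d p) A21 Aun"
    and FP: "F * P = four_block_mat Fob (0\<^sub>m r p) (0\<^sub>m 0 d) (0\<^sub>m 0 p)"
    and z: "z1 \<in> carrier_vec d" "z2 \<in> carrier_vec p"
  shows "(F * A ^\<^sub>m k) *\<^sub>v (P *\<^sub>v (z1 @\<^sub>v z2)) = (Fob * Aob ^\<^sub>m k) *\<^sub>v z1"
  using z
\<comment> \<open>One step turns \<open>z2\<close> into a vector that also involves
  \<open>z1\<close>, so both are generalised.\<close>
proof (induction k arbitrary: z1 z2)
  case 0
  note z = 0
  have zz: "z1 @\<^sub>v z2 \<in> carrier_vec n" unfolding n by (rule append_carrier_vec[OF z])
  have "(F * A ^\<^sub>m 0) *\<^sub>v (P *\<^sub>v (z1 @\<^sub>v z2)) = (F * P) *\<^sub>v (z1 @\<^sub>v z2)"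
    using assoc_mult_mat_vec[OF F P zz] right_mult_one_mat[OF F] A by simp
  also have "\<dots> = (Fob *\<^sub>v z1 + 0\<^sub>m r p *\<^sub>v z2) @\<^sub>v (0\<^sub>m 0 d *\<^sub>v z1 + 0\<^sub>m 0 p *\<^sub>v z2)"
    unfolding FP by (rule four_block_mat_mult_vec[OF Fob _ _ _ z]) auto
  \<comment> \<open>The lower blocks have no rows, so they append the empty vector.\<close>
  also have "\<dots> = Fob *\<^sub>v z1"
    by (rule eq_vecI) (use Fob z in \<open>auto simp: append_vec_def\<close>)
  also have "\<dots> = (Fob * Aob ^\<^sub>m 0) *\<^sub>v z1"
    using right_mult_one_mat[OF Fob] Aob by simp
  finally show ?case .
next
  case (Suc k)
  note z = Suc.prems
  have zz: "z1 @\<^sub>v z2 \<in> carrier_vec n" unfolding n by (rule append_carrier_vec[OF z])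
  have Pz: "P *\<^sub>v (z1 @\<^sub>v z2) \<in> carrier_vec n" by (rule mult_mat_vec_carrier[OF P zz])
  have APz: "A *\<^sub>v (P *\<^sub>v (z1 @\<^sub>v z2)) \<in> carrier_vec n" by (rule mult_mat_vec_carrier[OF A Pz])
  have z1': "Aob *\<^sub>v z1 \<in> carrier_vec d" by (rule mult_mat_vec_carrier[OF Aob z(1)])
  have z2': "A21 *\<^sub>v z1 + Aun *\<^sub>v z2 \<in> carrier_vec p"
    by (intro add_carrier_vec mult_mat_vec_carrier[OF A21 z(1)] mult_mat_vec_carrier[OF Aun z(2)])
  have "A *\<^sub>v (P *\<^sub>v (z1 @\<^sub>v z2)) = (P * Q) *\<^sub>v (A *\<^sub>v (P *\<^sub>v (z1 @\<^sub>v z2)))"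
    unfolding PQ using APz by simp
  also have "\<dots> = P *\<^sub>v ((Q * A * P) *\<^sub>v (z1 @\<^sub>v z2))"
    unfolding assoc_mult_mat_vec[OF P Q APz] assoc_mult_mat_vec[OF mult_carrier_mat[OF Q A] P zz]
      assoc_mult_mat_vec[OF Q A Pz] ..
  also have "(Q * A * P) *\<^sub>v (z1 @\<^sub>v z2) =
      (Aob *\<^sub>v z1 + 0\<^sub>m d p *\<^sub>v z2) @\<^sub>v (A21 *\<^sub>v z1 + Aun *\<^sub>v z2)"
    unfolding QAP by (rule four_block_mat_mult_vec[OF Aob _ A21 Aun z]) simp
  also have "Aob *\<^sub>v z1 + 0\<^sub>m d p *\<^sub>v z2 = Aob *\<^sub>v z1"
    unfolding zero_mat_mult_vec[OF z(2)] by (rule right_zero_vec[OF z1'])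
  finally have step: "A *\<^sub>v (P *\<^sub>v (z1 @\<^sub>v z2)) = P *\<^sub>v (Aob *\<^sub>v z1 @\<^sub>v (A21 *\<^sub>v z1 + Aun *\<^sub>v z2))" .
  show ?case
    unfolding mult_pow_Suc_mat_vec[OF A F Pz] mult_pow_Suc_mat_vec[OF Aob Fob z(1)] step
    by (rule Suc.IH[OF z1' z2'])
qed

lemma observable_iff:
  assumes A: "A \<in> carrier_mat n n" and F: "F \<in> carrier_mat r n"
  shows "observable A F \<longleftrightarrow>
    (\<forall>x\<in>carrier_vec n. (\<forall>k. (F * A ^\<^sub>m k) *\<^sub>v x = 0\<^sub>v r) \<longrightarrow> x = 0\<^sub>v n)"
proof -
  have "obs_mat A F \<in> carrier_mat (dim_row (obs_mat A F)) n"
    unfolding obs_mat_def by (rule obs_stack_carrier[OF A F])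
  then have "observable A F \<longleftrightarrow> mat_kernel (obs_mat A F) = {0\<^sub>v n}"
    unfolding observable_def carrier_matD(1)[OF A] by (rule mat_rank_full_iff)
  moreover have "(F * A ^\<^sub>m k) *\<^sub>v 0\<^sub>v n = 0\<^sub>v r" for k
    by (rule mult_mat_zero_vec[OF mult_carrier_mat[OF F pow_carrier_mat[OF A]]])
  ultimately show ?thesis unfolding mat_kernel_obs_mat[OF A F] by auto
qed

text \<open>With a basis whose last \<open>p\<close> vectors span the unobservable subspace, the
  zero blocks say that this subspace is invariant under \<open>A\<close> and annihilated by
  \<open>F\<close>. The upper block is observable because a vector with coordinates
  \<open>z\<close>, 0 and vanishing outputs lies in the subspace, so its leading coordinates are
  zero.\<close>

lemma observable_subsystem_exists:
  assumes A: "A \<in> carrier_mat n n" and F: "F \<in> carrier_mat r n"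
  shows "\<exists>Aob Fob. observable_subsystem A F Aob Fob"
proof -
  define M where "M = obs_mat A F"
  have M: "M \<in> carrier_mat (dim_row M) n"
    unfolding M_def obs_mat_def by (rule obs_stack_carrier[OF A F])
  define p where "p = kernel_dim M"
  define d where "d = n - p"
  have n: "n = d + p" using kernel_dim_le[OF M] by (simp add: d_def p_def)
  obtain P Q where P: "P \<in> carrier_mat n n" and Q: "Q \<in> carrier_mat n n"
    and PQ: "P * Q = 1\<^sub>m n" and QP: "Q * P = 1\<^sub>m n"
    and "\<And>z. z \<in> carrier_vec n \<Longrightarrow>
      M *\<^sub>v (P *\<^sub>v z) = 0\<^sub>v (dim_row M) \<longleftrightarrow> (\<forall>i<n - kernel_dim M. z $ i = 0)"
    using kernel_adapted_basis[OF M] by blast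
  then have ker: "(\<forall>k. (F * A ^\<^sub>m k) *\<^sub>v (P *\<^sub>v z) = 0\<^sub>v r) \<longleftrightarrow> (\<forall>i<d. z $ i = 0)"
    if "z \<in> carrier_vec n" for z
    using that mat_kernel[OF M] mat_kernel_obs_mat[OF A F] mult_mat_vec_carrier[OF P that]
    unfolding d_def p_def M_def by blast
  define G where "G = Q * A * P"
  define H where "H = F * P"
  have G: "G \<in> carrier_mat n n" and H: "H \<in> carrier_mat r n"
    using A F P Q by (auto simp: G_def H_def)
  define Aob where "Aob = mat d d (\<lambda>(i, j). G $$ (i, j))"
  define A21 where "A21 = mat p d (\<lambda>(i, j). G $$ (i + d, j))"
  define Aun where "Aun = mat p p (\<lambda>(i, j). G $$ (i + d, j + d))"
  define Fob where "Fob = mat r d (\<lambda>(i, j). H $$ (i, j))"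
  have c: "Aob \<in> carrier_mat d d" "A21 \<in> carrier_mat p d" "Aun \<in> carrier_mat p p"
    "Fob \<in> carrier_mat r d" by (simp_all add: Aob_def A21_def Aun_def Fob_def)
  have unobs: "(F * A ^\<^sub>m k) *\<^sub>v col P j = 0\<^sub>v r" if "d \<le> j" "j < n" for j k
  proof -
    have "col P j = P *\<^sub>v unit_vec n j"
      using mult_mat_unit_vec[OF P that(2)] by simp
    moreover have "\<forall>i<d. unit_vec n j $ i = (0 :: real)" using that n by simp
    ultimately show ?thesis using ker[OF unit_vec_carrier] by metis
  qed
  have H0: "H $$ (i, j) = 0" if "i < r" "d \<le> j" "j < n" for i j
  proof -
    have "col H j = F *\<^sub>v col P j" unfolding H_def using col_mult2[OF F P that(3)] .
    also have "\<dots> = 0\<^sub>v r" using unobs[OF that(2,3), of 0] right_mult_one_mat[OF F] A by simp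
    finally have "col H j $ i = 0" using that by simp
    then show ?thesis using H that by simp
  qed
  \<comment> \<open>The coordinates of \<open>A *\<^sub>v col P j\<close> are read off by
    \<open>Q\<close>. This vector is again unobservable, since its outputs are those of
    \<open>col P j\<close> shifted by one step.\<close>
  have G0: "G $$ (i, j) = 0" if "i < d" "d \<le> j" "j < n" for i j
  proof -
    have v: "col P j \<in> carrier_vec n" using col_carrier_vec[OF that(3) P] .
    have Av: "A *\<^sub>v col P j \<in> carrier_vec n" by (rule mult_mat_vec_carrier[OF A v])
    have z: "Q *\<^sub>v (A *\<^sub>v col P j) \<in> carrier_vec n" by (rule mult_mat_vec_carrier[OF Q Av])
    have G': "col G j = Q *\<^sub>v (A *\<^sub>v col P j)"
      unfolding G_def col_mult2[OF mult_carrier_mat[OF Q A] P that(3)] by (rule assoc_mult_mat_vec[OF Q A v])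
    have "P *\<^sub>v (Q *\<^sub>v (A *\<^sub>v col P j)) = A *\<^sub>v col P j"
      unfolding assoc_mult_mat_vec[OF P Q Av, symmetric] PQ using Av by simp
    moreover have "(F * A ^\<^sub>m k) *\<^sub>v (A *\<^sub>v col P j) = 0\<^sub>v r" for k
      unfolding mult_pow_Suc_mat_vec[OF A F v, symmetric] by (rule unobs[OF that(2,3)])
    ultimately have "\<forall>i<d. (Q *\<^sub>v (A *\<^sub>v col P j)) $ i = 0"
      using ker[OF z] by simp
    then have "col G j $ i = 0" using that G' by simp
    then show ?thesis using G that n by simp
  qed
  have G4: "G = four_block_mat Aob (0\<^sub>m d p) A21 Aun"
    by (rule eq_matI) (use G G0 n in \<open>auto simp: Aob_def A21_def Aun_def\<close>)
  have H4: "H = four_block_mat Fob (0\<^sub>m r p) (0\<^sub>m 0 d) (0\<^sub>m 0 p)"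
    by (rule eq_matI) (use H H0 n in \<open>auto simp: Fob_def\<close>)
  have "observable Aob Fob"
    unfolding observable_iff[OF c(1,4)]
  proof (intro ballI impI)
    fix z assume z: "z \<in> carrier_vec d" and 0: "\<forall>k. (Fob * Aob ^\<^sub>m k) *\<^sub>v z = 0\<^sub>v r"
    have zn: "z @\<^sub>v 0\<^sub>v p \<in> carrier_vec n" unfolding n by (rule append_carrier_vec[OF z]) simp
    have "(F * A ^\<^sub>m k) *\<^sub>v (P *\<^sub>v (z @\<^sub>v 0\<^sub>v p)) = 0\<^sub>v r" for k
      using block_triangular_output[OF A F P Q PQ n c(1-4) G4[unfolded G_def] H4[unfolded H_def] z
          zero_carrier_vec] 0 by simp
    then have "\<forall>i<d. (z @\<^sub>v 0\<^sub>v p) $ i = 0" using ker[OF zn] by simp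
    then show "z = 0\<^sub>v d" using z by (intro eq_vecI) auto
  qed
  moreover have "inverts_mat P Q" "inverts_mat Q P"
    using P Q PQ QP by (auto simp: inverts_mat_def)
  ultimately have "observable_subsystem A F Aob Fob"
    unfolding observable_subsystem_def Let_def carrier_matD(1)[OF A] carrier_matD(1)[OF F]
      M_def[symmetric] p_def[symmetric] d_def[symmetric]
    using P Q c G4 H4 unfolding G_def H_def by blast
  then show ?thesis by blast
qed

text \<open>The outputs from \<open>x\<close> are those of the subsystem from \<open>z1\<close>. The
  first \<nu> blocks of the subsystem have full column rank, so \<nu> vanishing outputs force
  \<open>z1 = 0\<close>.\<close>

lemma observability_index_determines:
  assumes A: "A \<in> carrier_mat n n" and F: "F \<in> carrier_mat r n"
    and sub: "observable_subsystem A F Aob Fob" and x: "x \<in> carrier_vec n"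
    and 0: "\<And>i. i < observability_index Aob Fob \<Longrightarrow> (F * A ^\<^sub>m i) *\<^sub>v x = 0\<^sub>v r"
  shows "(F * A ^\<^sub>m k) *\<^sub>v x = 0\<^sub>v r"
proof -
  define p where "p = kernel_dim (obs_mat A F)"
  define d where "d = n - p"
  have "obs_mat A F \<in> carrier_mat (dim_row (obs_mat A F)) n"
    unfolding obs_mat_def by (rule obs_stack_carrier[OF A F])
  then have n: "n = d + p" using kernel_dim_le[of "obs_mat A F"] by (simp add: d_def p_def)
  obtain P Q A21 Aun where Aob: "Aob \<in> carrier_mat d d" and Fob: "Fob \<in> carrier_mat r d"
    and obs: "observable Aob Fob"
    and P: "P \<in> carrier_mat n n" and Q: "Q \<in> carrier_mat n n" and inv: "inverts_mat P Q"
    and A21: "A21 \<in> carrier_mat p d" and Aun: "Aun \<in> carrier_mat p p"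
    and QAP: "Q * A * P = four_block_mat Aob (0\<^sub>m d p) A21 Aun"
    and FP: "F * P = four_block_mat Fob (0\<^sub>m r p) (0\<^sub>m 0 d) (0\<^sub>m 0 p)"
    using sub unfolding observable_subsystem_def Let_def carrier_matD(1)[OF A] carrier_matD(1)[OF F]
      p_def[symmetric] d_def[symmetric] by blast
  have PQ: "P * Q = 1\<^sub>m n" using inv P by (simp add: inverts_mat_def)
  define z where "z = Q *\<^sub>v x"
  have z: "z \<in> carrier_vec n" unfolding z_def by (rule mult_mat_vec_carrier[OF Q x])
  have Pz: "P *\<^sub>v z = x" unfolding z_def assoc_mult_mat_vec[OF P Q x, symmetric] PQ using x by simp
  define z1 where "z1 = vec_first z d"
  define z2 where "z2 = vec_last z p"
  have z12: "z1 \<in> carrier_vec d" "z2 \<in> carrier_vec p" by (simp_all add: z1_def z2_def)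
  have zz: "z1 @\<^sub>v z2 = z" using z unfolding z1_def z2_def n by simp
  have out: "(F * A ^\<^sub>m k) *\<^sub>v x = (Fob * Aob ^\<^sub>m k) *\<^sub>v z1" for k
    using block_triangular_output[OF A F P Q PQ n Aob A21 Aun Fob QAP FP z12] unfolding zz Pz .
  let ?l = "observability_index Aob Fob"
  \<comment> \<open>The least number exists: by observability, \<open>dim_row Aob\<close> blocks
    already have full rank.\<close>
  have "mat_rank (obs_stack Aob Fob ?l) = dim_row Aob"
    unfolding observability_index_def
    by (rule LeastI[of _ "dim_row Aob"]) (use obs in \<open>simp add: observable_def obs_mat_def\<close>)
  then have "mat_kernel (obs_stack Aob Fob ?l) = {0\<^sub>v d}"
    using mat_rank_full_iff[OF obs_stack_carrier[OF Aob Fob]] Aob by simp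
  moreover have "z1 \<in> mat_kernel (obs_stack Aob Fob ?l)"
    unfolding mat_kernel_obs_stack[OF Aob Fob] using z12 0 out by simp
  ultimately have "z1 = 0\<^sub>v d" by blast
  then show ?thesis
    unfolding out using mult_mat_zero_vec[OF mult_carrier_mat[OF Fob pow_carrier_mat[OF Aob]]]
    by simp
qed

text \<open>The choice behind \<open>dt_sigma\<close> is meaningful because a subsystem exists; the
  later argument works for whichever one was chosen.\<close>

lemma dt_sigma_eq:
  assumes "A \<in> carrier_mat n n" "F \<in> carrier_mat r n"
  obtains Aob Fob where "observable_subsystem A F Aob Fob"
    "dt_sigma A F = int (observability_index Aob Fob) - 2"
proof -
  have "\<exists>s Aob Fob. observable_subsystem A F Aob Fob \<and> s = int (observability_index Aob Fob) - 2"
    using observable_subsystem_exists[OF assms] by blast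
  from someI_ex[OF this, folded dt_sigma_def] show thesis using that by blast
qed

subsection \<open>Discrete time\<close>

text \<open>A map factors through the data exactly when the data determine its value. Given
  uniqueness, \<open>R\<close> selects any output value produced by some trajectory with these data.
  The arbitrary \<open>traj\<close> lets this serve both time settings.\<close>

lemma reconstructible_iff:
  "reconstructible traj n C D F ts tb \<longleftrightarrow>
    (\<forall>x0\<in>carrier_vec n. \<forall>x0'\<in>carrier_vec n. \<forall>u x u' x'.
      traj x0 u x \<longrightarrow> traj x0' u' x' \<longrightarrow> (\<forall>t\<in>{0..tb}. u t = u' t) \<longrightarrow>
      (\<forall>s\<in>set ts. C *\<^sub>v x s + D *\<^sub>v u s = C *\<^sub>v x' s + D *\<^sub>v u' s) \<longrightarrow>
      (\<forall>t\<in>{0..tb}. F *\<^sub>v x t = F *\<^sub>v x' t))" (is "_ \<longleftrightarrow> ?unique")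
proof
  assume "reconstructible traj n C D F ts tb"
  then obtain R where R: "\<forall>x0\<in>carrier_vec n. \<forall>u x. traj x0 u x \<longrightarrow> (\<forall>t\<in>{0..tb}.
      F *\<^sub>v x t = R (restrict u {0..tb}) (map (\<lambda>s. C *\<^sub>v x s + D *\<^sub>v u s) ts) t)"
    unfolding reconstructible_def by blast
  show ?unique
  proof (intro ballI allI impI)
    fix x0 x0' u x u' x' t
    assume x0: "x0 \<in> carrier_vec n" "x0' \<in> carrier_vec n"
      and traj: "traj x0 u x" "traj x0' u' x'"
      and u: "\<forall>t\<in>{0..tb}. u t = u' t"
      and y: "\<forall>s\<in>set ts. C *\<^sub>v x s + D *\<^sub>v u s = C *\<^sub>v x' s + D *\<^sub>v u' s"
      and t: "t \<in> {0..tb}"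
    have "restrict u {0..tb} = restrict u' {0..tb}" using u by (simp add: restrict_def fun_eq_iff)
    moreover have "map (\<lambda>s. C *\<^sub>v x s + D *\<^sub>v u s) ts = map (\<lambda>s. C *\<^sub>v x' s + D *\<^sub>v u' s) ts"
      using y unfolding map_eq_conv .
    ultimately show "F *\<^sub>v x t = F *\<^sub>v x' t"
      unfolding R[rule_format, OF x0(1) traj(1) t] R[rule_format, OF x0(2) traj(2) t] by (simp only:)
  qed
next
  assume unique: ?unique
  define cand where "cand v ys t w \<longleftrightarrow> (\<exists>x0\<in>carrier_vec n. \<exists>u x. traj x0 u x \<and>
    restrict u {0..tb} = v \<and> map (\<lambda>s. C *\<^sub>v x s + D *\<^sub>v u s) ts = ys \<and> w = F *\<^sub>v x t)" for v ys t w
  have "F *\<^sub>v x t = (SOME w. cand (restrict u {0..tb}) (map (\<lambda>s. C *\<^sub>v x s + D *\<^sub>v u s) ts) t w)"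
    if x0: "x0 \<in> carrier_vec n" and traj: "traj x0 u x" and t: "t \<in> {0..tb}" for x0 u x t
  proof -
    have "cand (restrict u {0..tb}) (map (\<lambda>s. C *\<^sub>v x s + D *\<^sub>v u s) ts) t (F *\<^sub>v x t)"
      unfolding cand_def using x0 traj by blast
    \<comment> \<open>The selected value stems from some trajectory with the same data, possibly
      another one; uniqueness identifies the two outputs.\<close>
    from someI[of "cand (restrict u {0..tb}) (map (\<lambda>s. C *\<^sub>v x s + D *\<^sub>v u s) ts) t", OF this]
    obtain x0' u' x' where x': "x0' \<in> carrier_vec n" "traj x0' u' x'"
      and u: "restrict u' {0..tb} = restrict u {0..tb}"
      and y: "map (\<lambda>s. C *\<^sub>v x' s + D *\<^sub>v u' s) ts = map (\<lambda>s. C *\<^sub>v x s + D *\<^sub>v u s) ts"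
      and w: "(SOME w. cand (restrict u {0..tb}) (map (\<lambda>s. C *\<^sub>v x s + D *\<^sub>v u s) ts) t w) = F *\<^sub>v x' t"
      unfolding cand_def by blast
    have "\<forall>t\<in>{0..tb}. u t = u' t" using u by (metis restrict_apply')
    moreover have "\<forall>s\<in>set ts. C *\<^sub>v x s + D *\<^sub>v u s = C *\<^sub>v x' s + D *\<^sub>v u' s"
      using y[symmetric] unfolding map_eq_conv .
    ultimately have "F *\<^sub>v x t = F *\<^sub>v x' t"
      using unique[rule_format, OF x0 x'(1) traj x'(2)] t by blast
    then show ?thesis using w by simp
  qed
  then show "reconstructible traj n C D F ts tb"
    unfolding reconstructible_def
    by (intro exI[of _ "\<lambda>v ys t. SOME w. cand v ys t w"]) blast
qed

section \<open>Differences of states, and the rank condition in terms of kernels\<close>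

lemma diff_eq_zero_vec_iff:
  fixes a b :: "'a :: group_add vec"
  assumes "a \<in> carrier_vec n" "b \<in> carrier_vec n"
  shows "a - b = 0\<^sub>v n \<longleftrightarrow> a = b"
  using assms by (auto simp: vec_eq_iff)

lemma mult_mat_vec_eq_iff:
  fixes M :: "'a :: ring mat"
  assumes M: "M \<in> carrier_mat nr nc" and x: "x \<in> carrier_vec nc" "y \<in> carrier_vec nc"
  shows "M *\<^sub>v x = M *\<^sub>v y \<longleftrightarrow> M *\<^sub>v (x - y) = 0\<^sub>v nr"
  unfolding mult_minus_distrib_mat_vec[OF M x]
  using diff_eq_zero_vec_iff[OF mult_mat_vec_carrier[OF M x(1)] mult_mat_vec_carrier[OF M x(2)]]
  by simp

lemma add_right_cancel_vec:
  fixes a b c :: "'a :: ring vec"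
  assumes "a \<in> carrier_vec n" "b \<in> carrier_vec n" "c \<in> carrier_vec n"
  shows "a + c = b + c \<longleftrightarrow> a = b"
  using assms by (auto simp: vec_eq_iff)

lemma add_diff_add_vec:
  fixes a b c :: "'a :: ab_group_add vec"
  assumes "a \<in> carrier_vec n" "b \<in> carrier_vec n" "c \<in> carrier_vec n"
  shows "(a + c) - (b + c) = a - b"
  using assms by (intro eq_vecI) auto

text \<open>\<open>G t\<close> stands for a sample block, formed with a matrix power or a matrix
  exponential, so one reduction covers both settings.\<close>

lemma mat_rank_sample_iff:
  assumes A: "A \<in> carrier_mat n n" and F: "F \<in> carrier_mat r n"
    and G: "\<And>t. t \<in> set ts \<Longrightarrow> G t \<in> carrier_mat q n"
  shows "mat_rank (vstack n (map G ts) @\<^sub>r obs_mat A F) = mat_rank (vstack n (map G ts)) \<longleftrightarrow>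
    (\<forall>x\<in>carrier_vec n. (\<forall>t\<in>set ts. G t *\<^sub>v x = 0\<^sub>v q) \<longrightarrow> (\<forall>k. (F * A ^\<^sub>m k) *\<^sub>v x = 0\<^sub>v r))"
proof -
  have obs: "obs_mat A F \<in> carrier_mat (dim_row (obs_mat A F)) n"
    unfolding obs_mat_def by (rule obs_stack_carrier[OF A F])
  have V: "vstack n (map G ts) \<in> carrier_mat (sum_list (map (dim_row \<circ> G) ts)) n"
    by (rule vstack_map_carrier[OF G])
  have K: "mat_kernel (vstack n (map G ts)) =
      {x \<in> carrier_vec n. \<forall>t\<in>set ts. G t *\<^sub>v x = 0\<^sub>v q}"
    by (rule mat_kernel_vstack_map[OF G])
  show ?thesis
    unfolding mat_rank_append_rows_eq_iff[OF V obs] mat_kernel_obs_mat[OF A F] K by blast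
qed

text \<open>The recurrence is assumed only before \<open>tb\<close> because a difference of
  trajectories is a free motion only while the inputs are known to agree.\<close>

lemma linear_recurrence_output:
  fixes A N :: "'a :: comm_semiring_1 mat" and e :: "nat \<Rightarrow> 'a vec"
  assumes A: "A \<in> carrier_mat n n" and N: "N \<in> carrier_mat r n"
    and e: "\<And>t. e t \<in> carrier_vec n"
    and step: "\<And>t. t < tb \<Longrightarrow> e (Suc t) = A *\<^sub>v e t"
    and t: "t \<le> tb"
  shows "N *\<^sub>v e t = (N * A ^\<^sub>m t) *\<^sub>v e 0"
proof -
  \<comment> \<open>The power \<open>k\<close> is generalised: each step back in time moves one
    factor \<open>A\<close> from the state into the output.\<close>
  have "(N * A ^\<^sub>m k) *\<^sub>v e t = (N * A ^\<^sub>m (k + t)) *\<^sub>v e 0" if "t \<le> tb" for k t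
    using that
  proof (induction t arbitrary: k)
    case (Suc t)
    have "(N * A ^\<^sub>m k) *\<^sub>v e (Suc t) = (N * A ^\<^sub>m Suc k) *\<^sub>v e t"
      unfolding mult_pow_Suc_mat_vec[OF A N e] using step Suc.prems by simp
    also have "\<dots> = (N * A ^\<^sub>m (Suc k + t)) *\<^sub>v e 0" by (rule Suc.IH) (use Suc.prems in simp)
    finally show ?case by simp
  qed simp
  from this[OF t, of 0] show ?thesis using right_mult_one_mat[OF N] A by simp
qed

text \<open>Necessity compares the free motion from \<open>x\<close> with the zero motion: both have
  zero input and equal samples, so no reconstruction can tell them apart. Sufficiency applies the
  kernel condition to the initial difference of two trajectories, in which the common input
  cancels.\<close>

lemma dt_observable_iff:
  assumes A: "A \<in> carrier_mat n n" and B: "B \<in> carrier_mat n m"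
    and C: "C \<in> carrier_mat q n" and D: "D \<in> carrier_mat q m" and F: "F \<in> carrier_mat r n"
  shows "dt_sb_functionally_observable A B C D F ts \<longleftrightarrow>
    (\<forall>x\<in>carrier_vec n. (\<forall>t\<in>set ts. (C * A ^\<^sub>m t) *\<^sub>v x = 0\<^sub>v q) \<longrightarrow>
      (\<forall>k. (F * A ^\<^sub>m k) *\<^sub>v x = 0\<^sub>v r))" (is "_ \<longleftrightarrow> ?kernel")
proof
  assume "dt_sb_functionally_observable A B C D F ts"
  then obtain tb where tb: "int tb > dt_sigma A F"
    and "reconstructible (dt_trajectory A B) n C D F ts tb"
    unfolding dt_sb_functionally_observable_def carrier_matD(1)[OF A] by blast
  note unique = this(2)[unfolded reconstructible_iff, rule_format]
  obtain Aob Fob where sub: "observable_subsystem A F Aob Fob"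
    and sigma: "dt_sigma A F = int (observability_index Aob Fob) - 2"
    using dt_sigma_eq[OF A F] by blast
  show ?kernel
  proof (intro ballI impI allI)
    fix x k assume x: "x \<in> carrier_vec n" and y0: "\<forall>t\<in>set ts. (C * A ^\<^sub>m t) *\<^sub>v x = 0\<^sub>v q"
    define X where "X t = ((\<lambda>v. A *\<^sub>v v) ^^ t) x" for t :: nat
    have X0: "X 0 = x" and XSuc: "\<And>t. X (Suc t) = A *\<^sub>v X t" by (simp_all add: X_def)
    have X: "X t \<in> carrier_vec n" for t
      by (induction t) (simp_all only: X0 x XSuc mult_mat_vec_carrier[OF A])
    have out: "N *\<^sub>v X t = (N * A ^\<^sub>m t) *\<^sub>v x" if "N \<in> carrier_mat l n" for N l t
      using linear_recurrence_output[of A n N l X t t, OF A that X XSuc order_refl] unfolding X0 .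
    have zero: "A *\<^sub>v v + B *\<^sub>v 0\<^sub>v m = A *\<^sub>v v" if "v \<in> carrier_vec n" for v
      unfolding mult_mat_zero_vec[OF B] by (rule right_zero_vec[OF mult_mat_vec_carrier[OF A that]])
    have "dt_trajectory A B x (\<lambda>_. 0\<^sub>v m) X"
      unfolding dt_trajectory_def carrier_matD(1)[OF A] carrier_matD(2)[OF B]
      using X0 X XSuc zero[OF X] by simp
    moreover have "dt_trajectory A B (0\<^sub>v n) (\<lambda>_. 0\<^sub>v m) (\<lambda>_. 0\<^sub>v n)"
      unfolding dt_trajectory_def carrier_matD(1)[OF A] carrier_matD(2)[OF B]
      using zero[OF zero_carrier_vec] mult_mat_zero_vec[OF A] by simp
    moreover have "C *\<^sub>v X s + D *\<^sub>v 0\<^sub>v m = C *\<^sub>v 0\<^sub>v n + D *\<^sub>v 0\<^sub>v m" if "s \<in> set ts" for s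
      unfolding out[OF C] mult_mat_zero_vec[OF C] using y0 that by simp
    ultimately have "F *\<^sub>v X t = F *\<^sub>v 0\<^sub>v n" if "t \<in> {0..tb}" for t
      using unique[OF x zero_carrier_vec _ _ _ _ that] by blast
    then have FX: "(F * A ^\<^sub>m t) *\<^sub>v x = 0\<^sub>v r" if "t \<le> tb" for t
      using that unfolding out[OF F] mult_mat_zero_vec[OF F] by simp
    \<comment> \<open>Over the integers, \<open>tb\<close> above \<nu> - 2 means at least \<nu> - 1,
      so every index below \<nu> is a time covered by \<open>FX\<close>.\<close>
    show "(F * A ^\<^sub>m k) *\<^sub>v x = 0\<^sub>v r"
      by (rule observability_index_determines[OF A F sub x], rule FX) (use tb sigma in linarith)
  qed
next
  assume kernel: ?kernel
  \<comment> \<open>The horizon passes every sampling time, so that the input entering a sample is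
    known, and exceeds sigma, which may be negative. The inserted 0 keeps \<open>Max\<close> defined
    for an empty list.\<close>
  define tb where "tb = Max (insert 0 (set ts)) + nat \<bar>dt_sigma A F\<bar> + 1"
  have ts: "t \<le> tb" if "t \<in> set ts" for t
  proof -
    have "t \<le> Max (insert 0 (set ts))" using that by (intro Max_ge) auto
    then show ?thesis unfolding tb_def by linarith
  qed
  have sigma: "int tb > dt_sigma A F" unfolding tb_def by linarith
  have "reconstructible (dt_trajectory A B) n C D F ts tb"
    unfolding reconstructible_iff
  proof (intro ballI allI impI)
    fix x0 x0' u x u' x' t
    assume "dt_trajectory A B x0 u x" "dt_trajectory A B x0' u' x'"
      and u: "\<forall>t\<in>{0..tb}. u t = u' t"
      and y: "\<forall>s\<in>set ts. C *\<^sub>v x s + D *\<^sub>v u s = C *\<^sub>v x' s + D *\<^sub>v u' s"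
      and t: "t \<in> {0..tb}"
    then have x: "\<And>t. x t \<in> carrier_vec n" "\<And>t. x' t \<in> carrier_vec n"
      and uc: "\<And>t. u t \<in> carrier_vec m"
      and step: "\<And>t. x (Suc t) = A *\<^sub>v x t + B *\<^sub>v u t" "\<And>t. x' (Suc t) = A *\<^sub>v x' t + B *\<^sub>v u' t"
      unfolding dt_trajectory_def carrier_matD(1)[OF A] carrier_matD(2)[OF B] by blast+
    define e where "e t = x t - x' t" for t
    have e: "e t \<in> carrier_vec n" for t unfolding e_def using x by simp
    have "e (Suc t) = A *\<^sub>v e t" if "t < tb" for t
    proof -
      have "u' t = u t" using u that by simp
      then show ?thesis
        unfolding e_def step mult_minus_distrib_mat_vec[OF A x(1) x(2)]
        using add_diff_add_vec[OF mult_mat_vec_carrier[OF A x(1)] mult_mat_vec_carrier[OF A x(2)]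
            mult_mat_vec_carrier[OF B uc]] by simp
    qed
    then have out: "N *\<^sub>v e t = (N * A ^\<^sub>m t) *\<^sub>v e 0" if "N \<in> carrier_mat l n" "t \<le> tb" for N l t
      using linear_recurrence_output[of A n N l e tb t, OF A that(1) e _ that(2)] by blast
    have "(C * A ^\<^sub>m s) *\<^sub>v e 0 = 0\<^sub>v q" if s: "s \<in> set ts" for s
    proof -
      have "u' s = u s" using u ts[OF s] by simp
      then have "C *\<^sub>v x s + D *\<^sub>v u s = C *\<^sub>v x' s + D *\<^sub>v u s" using y s by simp
      then have "C *\<^sub>v x s = C *\<^sub>v x' s"
        using add_right_cancel_vec[OF mult_mat_vec_carrier[OF C x(1)] mult_mat_vec_carrier[OF C x(2)]
            mult_mat_vec_carrier[OF D uc]] by blast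
      then show ?thesis
        using out[OF C ts[OF s]] mult_mat_vec_eq_iff[OF C x(1) x(2)] unfolding e_def by metis
    qed
    then have "(F * A ^\<^sub>m t) *\<^sub>v e 0 = 0\<^sub>v r" using kernel e by blast
    then show "F *\<^sub>v x t = F *\<^sub>v x' t"
      using out[OF F] t mult_mat_vec_eq_iff[OF F x(1) x(2)] unfolding e_def by (metis atLeastAtMost_iff)
  qed
  then show "dt_sb_functionally_observable A B C D F ts"
    unfolding dt_sb_functionally_observable_def carrier_matD(1)[OF A] using sigma by blast
qed

subsection \<open>Functions with zero derivative off a countable set\<close>

text \<open>Classical argument: after tilting \<open>f\<close> by a small slope, a level \<open>y\<close> between the end values
  that is avoided on the exceptional set is crossed downwards at its last crossing point.\<close>

lemma DERIV_zero_countable_le: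
  fixes f :: "real \<Rightarrow> real"
  assumes ab: "a \<le> b" and cont: "continuous_on {a..b} f" and E: "countable E"
    and deriv: "\<And>t. t \<in> {a<..<b} - E \<Longrightarrow> (f has_real_derivative 0) (at t)"
  shows "f b \<le> f a"
proof (rule ccontr)
  assume "\<not> f b \<le> f a"
  then have less: "f a < f b" by simp
  then have ab: "a < b" using ab by (cases "a = b") auto
  \<comment> \<open>Half the mean slope: the tilted function still climbs from \<open>a\<close> to
    \<open>b\<close>, while its derivative off \<open>E\<close> becomes \<open>- s\<close>.\<close>
  define s where "s = (f b - f a) / (2 * (b - a))"
  have s: "0 < s" using less ab by (simp add: s_def)
  define g where "g t = f t - s * (t - a)" for t
  have sba: "s * (b - a) = (f b - f a) / 2" using ab by (simp add: s_def field_simps)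
  have gab: "g a < g b" unfolding g_def sba using less by (simp add: field_simps)
  have cont_g: "continuous_on {a..b} g" unfolding g_def by (intro continuous_intros cont)
  have "\<not> {g a<..<g b} \<subseteq> g ` E"
    using uncountable_open_interval[of "g a" "g b"] gab countable_subset[OF _ countable_image[OF E]]
    by blast
  then obtain y where "y \<in> {g a<..<g b}" "y \<notin> g ` E" by blast
  then have y: "g a < y" "y < g b" "y \<notin> g ` E" by simp_all
  define S where "S = g -` {..y} \<inter> {a..b}"
  have "closed S"
    unfolding S_def using cont_g continuous_on_closed_vimage[of "{a..b}" g] by auto
  then have "compact S"
    using compact_Int_closed[of "{a..b}" S] compact_Icc[of a b] by (simp add: S_def Int_absorb1)
  moreover have "a \<in> S" using y ab by (simp add: S_def)
  ultimately obtain c where c: "c \<in> S" and max: "\<And>t. t \<in> S \<Longrightarrow> t \<le> c"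
    using compact_attains_sup[of S] by blast
  have cab: "a \<le> c" "c \<le> b" "g c \<le> y" using c by (auto simp: S_def)
  \<comment> \<open>The level \<open>y\<close> is attained between \<open>c\<close> and
    \<open>b\<close>, and the maximality of \<open>c\<close> puts that point at \<open>c\<close>
    itself.\<close>
  obtain d where d: "c \<le> d" "d \<le> b" "g d = y"
    using IVT'[of g c y b] cab y continuous_on_subset[OF cont_g, of "{c..b}"] by auto
  then have "d \<in> S" using cab by (simp add: S_def)
  then have gc: "g c = y" using max[of d] d by simp
  \<comment> \<open>The end values differ from \<open>y\<close>, and the level was chosen outside
    the image of \<open>E\<close>.\<close>
  then have "c \<in> {a<..<b} - E" using cab y by (auto simp: less_le)
  then have "(g has_real_derivative (0 - s * (1 - 0))) (at c)"
    unfolding g_def by (intro derivative_intros DERIV_cmult deriv)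
  then have "(g has_real_derivative - s) (at c)" by simp
  from DERIV_neg_dec_right[OF this] s obtain e
    where e: "e > 0" "\<And>h. 0 < h \<Longrightarrow> h < e \<Longrightarrow> g (c + h) < g c" by auto
  define h where "h = min (e / 2) (b - c)"
  have "c \<noteq> b" using gc y by auto
  then have h: "0 < h" "h < e" "c + h \<le> b" using e(1) cab by (auto simp: h_def)
  then have "c + h \<in> S" using e(2)[of h] gc cab by (simp add: S_def)
  then show False using max h(1) by force
qed

lemma DERIV_zero_countable_const:
  fixes f :: "real \<Rightarrow> real"
  assumes "a \<le> b" and cont: "continuous_on {a..b} f" and "countable E"
    and deriv: "\<And>t. t \<in> {a<..<b} - E \<Longrightarrow> (f has_real_derivative 0) (at t)"
  shows "f b = f a"
proof (rule antisym)
  show "f b \<le> f a" using assms by (rule DERIV_zero_countable_le)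
  have "- f b \<le> - f a"
  proof (rule DERIV_zero_countable_le[of a b "\<lambda>t. - f t" E])
    show "continuous_on {a..b} (\<lambda>t. - f t)" by (intro continuous_intros cont)
    show "((\<lambda>t. - f t) has_real_derivative 0) (at t)" if "t \<in> {a<..<b} - E" for t
      using DERIV_minus[OF deriv[OF that]] by simp
  qed fact+
  then show "f a \<le> f b" by simp
qed

subsection \<open>Exponential generating functions\<close>

text \<open>This growth makes the exponential series converge everywhere. The constant is hidden
  while the rate \<open>K\<close> stays visible: shifts and linear combinations change only the
  constant.\<close>

definition geom_bounded :: "real \<Rightarrow> (nat \<Rightarrow> real) \<Rightarrow> bool" where
  "geom_bounded K a \<longleftrightarrow> (\<exists>c. \<forall>k. \<bar>a k\<bar> \<le> c * K ^ k)"

text \<open>The exponential generating function of \<open>a\<close>: differentiation becomes a shift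
  of the sequence, and the powers of a matrix yield the entries of its exponential.\<close>

definition egf :: "(nat \<Rightarrow> real) \<Rightarrow> real \<Rightarrow> real" where
  "egf a t = (\<Sum>k. a k / fact k * t ^ k)"

lemma geom_bounded_Suc: "geom_bounded K a \<Longrightarrow> geom_bounded K (\<lambda>k. a (Suc k))"
  unfolding geom_bounded_def by (metis mult.assoc power_Suc)

lemma geom_bounded_cmult:
  assumes "geom_bounded K a"
  shows "geom_bounded K (\<lambda>k. w * a k)"
proof -
  obtain c where c: "\<And>k. \<bar>a k\<bar> \<le> c * K ^ k" using assms by (auto simp: geom_bounded_def)
  have "\<bar>w * a k\<bar> \<le> (\<bar>w\<bar> * c) * K ^ k" for k
    using mult_left_mono[OF c, of "\<bar>w\<bar>"] by (simp add: abs_mult mult.assoc)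
  then show ?thesis by (auto simp: geom_bounded_def)
qed

lemma geom_bounded_add:
  assumes "geom_bounded K a" "geom_bounded K b"
  shows "geom_bounded K (\<lambda>k. a k + b k)"
proof -
  obtain c d where "\<And>k. \<bar>a k\<bar> \<le> c * K ^ k" "\<And>k. \<bar>b k\<bar> \<le> d * K ^ k"
    using assms by (auto simp: geom_bounded_def)
  then have "\<bar>a k + b k\<bar> \<le> (c + d) * K ^ k" for k
    unfolding distrib_right by (intro order_trans[OF abs_triangle_ineq] add_mono)
  then show ?thesis by (auto simp: geom_bounded_def)
qed

lemma geom_bounded_sum:
  "(\<And>i. i \<in> I \<Longrightarrow> geom_bounded K (a i)) \<Longrightarrow> geom_bounded K (\<lambda>k. \<Sum>i\<in>I. w i * a i k)"
proof (induction I rule: infinite_finite_induct)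
  case (insert i I)
  then show ?case by (simp add: geom_bounded_add geom_bounded_cmult)
qed (auto simp: geom_bounded_def intro: exI[of _ 0])

lemma egf_sums:
  assumes "geom_bounded K a"
  shows "(\<lambda>k. a k / fact k * t ^ k) sums egf a t"
proof -
  obtain c where c: "\<And>k. \<bar>a k\<bar> \<le> c * K ^ k" using assms by (auto simp: geom_bounded_def)
  have "summable (\<lambda>k. c * (inverse (fact k) * \<bar>K * t\<bar> ^ k))"
    by (intro summable_mult summable_exp)
  moreover have "norm (a k / fact k * t ^ k) \<le> c * (inverse (fact k) * \<bar>K * t\<bar> ^ k)" for k
  proof -
    \<comment> \<open>The sign of \<open>K\<close> is unknown, so its powers are first replaced by
      those of its absolute value; the instance \<open>k = 0\<close> shows that \<open>c\<close> is
      nonnegative.\<close>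
    have c0: "0 \<le> c" using c[of 0] by simp
    have "\<bar>a k\<bar> \<le> c * \<bar>K\<bar> ^ k"
      using c[of k] mult_left_mono[OF abs_ge_self c0, of "K ^ k"] by (simp add: power_abs)
    then have "\<bar>a k\<bar> * (\<bar>t\<bar> ^ k / fact k) \<le> c * \<bar>K\<bar> ^ k * (\<bar>t\<bar> ^ k / fact k)"
      by (intro mult_right_mono) auto
    then show ?thesis
      by (simp add: abs_mult power_abs power_mult_distrib field_simps)
  qed
  ultimately have "summable (\<lambda>k. a k / fact k * t ^ k)"
    by (rule summable_comparison_test'[where N = 0])
  then show ?thesis unfolding egf_def by (rule summable_sums)
qed

lemma egf_sum:
  assumes "\<And>i. i \<in> I \<Longrightarrow> geom_bounded K (a i)"
  shows "egf (\<lambda>k. \<Sum>i\<in>I. w i * a i k) t = (\<Sum>i\<in>I. w i * egf (a i) t)"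
proof -
  have "(\<lambda>k. \<Sum>i\<in>I. w i * (a i k / fact k * t ^ k)) sums (\<Sum>i\<in>I. w i * egf (a i) t)"
    by (intro sums_sum sums_mult egf_sums[OF assms])
  then show ?thesis
    unfolding egf_def by (intro sums_unique[symmetric]) (simp add: sum_distrib_right sum_divide_distrib mult.assoc)
qed

lemma egf_0: "egf a 0 = a 0"
  unfolding egf_def using sums_unique[OF powser_sums_zero[of "\<lambda>k. a k / fact k"]] by simp

lemma egf_DERIV:
  assumes a: "geom_bounded K a"
  shows "(egf a has_real_derivative egf (\<lambda>k. a (Suc k)) t) (at t)"
proof -
  have "((\<lambda>t. \<Sum>k. a k / fact k * t ^ k) has_real_derivative
      (\<Sum>k. diffs (\<lambda>k. a k / fact k) k * t ^ k)) (at t)"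
    by (rule termdiffs_strong_converges_everywhere) (rule sums_summable[OF egf_sums[OF a]])
  moreover have "diffs (\<lambda>k. a k / fact k) = (\<lambda>k. a (Suc k) / fact k)"
    by (simp add: diffs_def fun_eq_iff del: of_nat_Suc)
  ultimately show ?thesis by (simp add: egf_def[abs_def])
qed

text \<open>Each derivative is the generating function of a shifted sequence, so all of them vanish
  on the open interval, and the value at 0 of the \<open>k\<close>-th is \<open>a k\<close>.\<close>

lemma egf_eq_zero_imp:
  assumes a: "geom_bounded K a" and T: "0 < T" and zero: "\<And>t. t \<in> {0..T} \<Longrightarrow> egf a t = 0"
  shows "a k = 0"
proof -
  have shift: "geom_bounded K (\<lambda>j. a (k + j))" for k
  proof (induction k)
    case (Suc k)
    from geom_bounded_Suc[OF this] show ?case by simp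
  qed (use a in simp)
  have "\<forall>t\<in>{0<..<T}. egf (\<lambda>j. a (k + j)) t = 0" for k
  proof (induction k)
    case 0
    show ?case using zero by simp
  next
    case (Suc k)
    show ?case
    proof
      fix t assume t: "t \<in> {0<..<T}"
      have "((\<lambda>_. 0) has_real_derivative egf (\<lambda>j. a (k + Suc j)) t) (at t)"
        using egf_DERIV[OF shift[of k], of t]
        by (rule has_field_derivative_transform_within_open[of _ _ _ "{0<..<T}"]) (use Suc t in auto)
      then show "egf (\<lambda>j. a (Suc k + j)) t = 0"
        using DERIV_unique[OF _ DERIV_const[of 0]] by simp
    qed
  qed
  \<comment> \<open>The point 0 is an end of the interval, so the value there is recovered as a
    limit from the right.\<close>
  then have "\<forall>\<^sub>F t in at_right 0. egf (\<lambda>j. a (k + j)) t = 0"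
    using T by (auto simp: eventually_at_right)
  then have "(egf (\<lambda>j. a (k + j)) \<longlongrightarrow> 0) (at_right 0)" by (rule tendsto_eventually)
  moreover have "(egf (\<lambda>j. a (k + j)) \<longlongrightarrow> egf (\<lambda>j. a (k + j)) 0) (at_right 0)"
    using DERIV_isCont[OF egf_DERIV[OF shift], of 0 k]
    unfolding isCont_def by (rule tendsto_within_subset) simp
  ultimately have "egf (\<lambda>j. a (k + j)) 0 = 0"
    using tendsto_unique[OF trivial_limit_at_right_real] by blast
  then show ?thesis by (simp add: egf_0)
qed

subsection \<open>Continuous time\<close>

lemma pow_mat_Suc_left:
  fixes A :: "'a :: semiring_1 mat"
  assumes A: "A \<in> carrier_mat n n"
  shows "A ^\<^sub>m Suc k = A * A ^\<^sub>m k"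
proof (induction k)
  case 0
  show ?case using A by simp
next
  case (Suc k)
  have "A ^\<^sub>m Suc (Suc k) = A * A ^\<^sub>m k * A" using Suc by simp
  also have "\<dots> = A * A ^\<^sub>m Suc k" using assoc_mult_mat[OF A pow_carrier_mat[OF A] A] by simp
  finally show ?case .
qed

lemma pow_mat_smult:
  fixes A :: "'a :: comm_semiring_1 mat"
  assumes A: "A \<in> carrier_mat n n"
  shows "(t \<cdot>\<^sub>m A) ^\<^sub>m k = t ^ k \<cdot>\<^sub>m A ^\<^sub>m k"
proof (induction k)
  case 0
  show ?case by (rule eq_matI) auto
next
  case (Suc k)
  note P = pow_carrier_mat[OF A, of k]
  show ?case
    unfolding pow_mat.simps Suc mult_smult_distrib[OF smult_carrier_mat[OF P] A]
      mult_smult_assoc_mat[OF P A] by (rule eq_matI) (simp_all add: mult.assoc)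
qed

lemma index_mult_mat_sum:
  assumes "M \<in> carrier_mat nr n" "N \<in> carrier_mat n nc" "i < nr" "j < nc"
  shows "(M * N) $$ (i, j) = (\<Sum>l<n. M $$ (i, l) * N $$ (l, j))"
  using assms by (simp add: scalar_prod_def atLeast0LessThan)

lemma index_mult_mat_vec_sum:
  assumes "M \<in> carrier_mat nr n" "v \<in> carrier_vec n" "i < nr"
  shows "(M *\<^sub>v v) $ i = (\<Sum>j<n. M $$ (i, j) * v $ j)"
  using assms by (simp add: scalar_prod_def atLeast0LessThan)

text \<open>Exhibits an output as a combination of the entries of \<open>M\<close> with fixed
  weights, the form that \<open>geom_bounded_sum\<close> and \<open>egf_sum\<close> accept.\<close>

lemma index_mult_mat_mat_vec_sum:
  fixes N M :: "real mat"
  assumes N: "N \<in> carrier_mat r n" and M: "M \<in> carrier_mat n n" and x: "x \<in> carrier_vec n"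
    and a: "a < r"
  shows "((N * M) *\<^sub>v x) $ a = (\<Sum>(j, l)\<in>{..<n} \<times> {..<n}. N $$ (a, l) * x $ j * M $$ (l, j))"
proof -
  have "((N * M) *\<^sub>v x) $ a = (\<Sum>j<n. (\<Sum>l<n. N $$ (a, l) * M $$ (l, j)) * x $ j)"
    unfolding index_mult_mat_vec_sum[OF mult_carrier_mat[OF N M] x a]
    by (intro sum.cong refl) (simp add: index_mult_mat_sum[OF N M a])
  also have "\<dots> = (\<Sum>j<n. \<Sum>l<n. N $$ (a, l) * x $ j * M $$ (l, j))"
    by (simp add: sum_distrib_left sum_distrib_right mult_ac)
  finally show ?thesis by (simp add: sum.cartesian_product)
qed

text \<open>The sum of all absolute entries bounds every column sum, so one more factor
  \<open>A\<close> multiplies the bound by at most this rate. The rate is common to all entries, so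
  they can be summed.\<close>

lemma pow_mat_geom_bounded:
  assumes A: "A \<in> carrier_mat n n" and ij: "i < n" "j < n"
  shows "geom_bounded (\<Sum>l<n. \<Sum>j<n. \<bar>A $$ (l, j)\<bar>) (\<lambda>k. (A ^\<^sub>m k) $$ (i, j))"
proof -
  define K where "K = (\<Sum>l<n. \<Sum>j<n. \<bar>A $$ (l, j)\<bar>)"
  have "\<bar>(A ^\<^sub>m k) $$ (i, j)\<bar> \<le> K ^ k" if "j < n" for k j
    using that
  proof (induction k arbitrary: j)
    case 0
    then show ?case using A ij by simp
  next
    case (Suc k)
    have "(A ^\<^sub>m Suc k) $$ (i, j) = (\<Sum>l<n. (A ^\<^sub>m k) $$ (i, l) * A $$ (l, j))"
      unfolding pow_mat.simps by (rule index_mult_mat_sum[OF pow_carrier_mat[OF A] A ij(1) Suc.prems])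
    then have "\<bar>(A ^\<^sub>m Suc k) $$ (i, j)\<bar> \<le> (\<Sum>l<n. \<bar>(A ^\<^sub>m k) $$ (i, l)\<bar> * \<bar>A $$ (l, j)\<bar>)"
      using sum_abs[of "\<lambda>l. (A ^\<^sub>m k) $$ (i, l) * A $$ (l, j)" "{..<n}"] by (simp only: abs_mult)
    also have "\<dots> \<le> (\<Sum>l<n. K ^ k * \<bar>A $$ (l, j)\<bar>)"
      by (intro sum_mono mult_right_mono Suc.IH) auto
    also have "\<dots> = K ^ k * (\<Sum>l<n. \<bar>A $$ (l, j)\<bar>)" by (simp add: sum_distrib_left)
    also have "\<dots> \<le> K ^ k * K"
      unfolding K_def using Suc.prems
      by (intro mult_left_mono sum_mono member_le_sum zero_le_power sum_nonneg) auto
    finally show ?case by (simp add: mult.commute)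
  qed
  then show ?thesis using ij(2) unfolding geom_bounded_def K_def[symmetric]
    by (intro exI[of _ 1]) simp
qed

section \<open>The matrix exponential, entry by entry\<close>

lemma mat_exp_carrier: "A \<in> carrier_mat n n \<Longrightarrow> mat_exp (t \<cdot>\<^sub>m A) \<in> carrier_mat n n"
  by (simp add: mat_exp_def)

lemma mat_exp_index:
  assumes A: "A \<in> carrier_mat n n" and ij: "i < n" "j < n"
  shows "mat_exp (t \<cdot>\<^sub>m A) $$ (i, j) = egf (\<lambda>k. (A ^\<^sub>m k) $$ (i, j)) t"
proof -
  have "((t \<cdot>\<^sub>m A) ^\<^sub>m k) $$ (i, j) / fact k = (A ^\<^sub>m k) $$ (i, j) / fact k * t ^ k" for k
    unfolding pow_mat_smult[OF A] using carrier_matD[OF pow_carrier_mat[OF A, of k]] ij by simp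
  then show ?thesis using A ij by (simp add: mat_exp_def egf_def)
qed

lemma mat_exp_0_mult_vec:
  assumes A: "A \<in> carrier_mat n n" and x: "x \<in> carrier_vec n"
  shows "mat_exp (0 \<cdot>\<^sub>m A) *\<^sub>v x = x"
proof -
  have "mat_exp (0 \<cdot>\<^sub>m A) = 1\<^sub>m n"
    by (rule eq_matI) (use A mat_exp_index[OF A] mat_exp_carrier[OF A, of 0] in \<open>auto simp: egf_0\<close>)
  then show ?thesis using x by simp
qed

text \<open>The derivative with \<open>A\<close> to the right of the exponential, as suits the
  uniqueness argument, where the exponential stands to the left of the state.\<close>

lemma mat_exp_index_DERIV:
  assumes A: "A \<in> carrier_mat n n" and ij: "i < n" "j < n"
  shows "((\<lambda>t. mat_exp (t \<cdot>\<^sub>m A) $$ (i, j)) has_real_derivative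
    (\<Sum>l<n. A $$ (l, j) * mat_exp (t \<cdot>\<^sub>m A) $$ (i, l))) (at t)"
proof -
  have "(A ^\<^sub>m Suc k) $$ (i, j) = (\<Sum>l<n. A $$ (l, j) * (A ^\<^sub>m k) $$ (i, l))" for k
    unfolding pow_mat.simps index_mult_mat_sum[OF pow_carrier_mat[OF A] A ij] by (simp only: mult.commute)
  then have "egf (\<lambda>k. (A ^\<^sub>m Suc k) $$ (i, j)) t = (\<Sum>l<n. A $$ (l, j) * mat_exp (t \<cdot>\<^sub>m A) $$ (i, l))"
    using egf_sum[OF pow_mat_geom_bounded[OF A ij(1)], of "{..<n}" "\<lambda>l. l" "\<lambda>l. A $$ (l, j)" t]
      mat_exp_index[OF A ij(1), of _ t] by simp
  then show ?thesis
    using egf_DERIV[OF pow_mat_geom_bounded[OF A ij], of t] by (simp only: mat_exp_index[OF A ij])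
qed

lemma output_geom_bounded:
  assumes A: "A \<in> carrier_mat n n" and N: "N \<in> carrier_mat r n" and x: "x \<in> carrier_vec n"
    and a: "a < r"
  shows "geom_bounded (\<Sum>l<n. \<Sum>j<n. \<bar>A $$ (l, j)\<bar>) (\<lambda>k. ((N * A ^\<^sub>m k) *\<^sub>v x) $ a)"
  unfolding index_mult_mat_mat_vec_sum[OF N pow_carrier_mat[OF A] x a] case_prod_beta
  by (rule geom_bounded_sum) (auto intro: pow_mat_geom_bounded[OF A])

text \<open>The vectors \<open>(N * A ^\<^sub>m k) *\<^sub>v x\<close> are the derivatives at time 0
  of the output along the free motion; this links observability to values on an interval.\<close>

lemma output_mat_exp:
  assumes A: "A \<in> carrier_mat n n" and N: "N \<in> carrier_mat r n" and x: "x \<in> carrier_vec n"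
    and a: "a < r"
  shows "((N * mat_exp (t \<cdot>\<^sub>m A)) *\<^sub>v x) $ a = egf (\<lambda>k. ((N * A ^\<^sub>m k) *\<^sub>v x) $ a) t"
proof -
  define K where "K = (\<Sum>l<n. \<Sum>j<n. \<bar>A $$ (l, j)\<bar>)"
  have "egf (\<lambda>k. \<Sum>p\<in>{..<n} \<times> {..<n}. N $$ (a, snd p) * x $ fst p * (A ^\<^sub>m k) $$ (snd p, fst p)) t =
      (\<Sum>p\<in>{..<n} \<times> {..<n}. N $$ (a, snd p) * x $ fst p * egf (\<lambda>k. (A ^\<^sub>m k) $$ (snd p, fst p)) t)"
    by (rule egf_sum[where K = K]) (auto simp: K_def intro: pow_mat_geom_bounded[OF A])
  also have "\<dots> = (\<Sum>p\<in>{..<n} \<times> {..<n}. N $$ (a, snd p) * x $ fst p * mat_exp (t \<cdot>\<^sub>m A) $$ (snd p, fst p))"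
    by (rule sum.cong) (auto simp: mat_exp_index[OF A])
  finally show ?thesis
    unfolding index_mult_mat_mat_vec_sum[OF N pow_carrier_mat[OF A] x a]
      index_mult_mat_mat_vec_sum[OF N mat_exp_carrier[OF A] x a] case_prod_beta by simp
qed

text \<open>A coordinate of the state is an output with \<open>N\<close> the identity; shifting its
  sequence gives the output for \<open>N = A\<close>.\<close>

lemma mat_exp_mult_vec_DERIV:
  assumes A: "A \<in> carrier_mat n n" and x: "x \<in> carrier_vec n" and i: "i < n"
  shows "((\<lambda>t. (mat_exp (t \<cdot>\<^sub>m A) *\<^sub>v x) $ i) has_real_derivative
    (A *\<^sub>v (mat_exp (t \<cdot>\<^sub>m A) *\<^sub>v x)) $ i) (at t)"
proof -
  note E = mat_exp_carrier[OF A]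
  have "(mat_exp (t \<cdot>\<^sub>m A) *\<^sub>v x) $ i = egf (\<lambda>k. ((1\<^sub>m n * A ^\<^sub>m k) *\<^sub>v x) $ i) t" for t
    using output_mat_exp[OF A one_carrier_mat x i, of t] left_mult_one_mat[OF E] by simp
  moreover have "(A *\<^sub>v (mat_exp (t \<cdot>\<^sub>m A) *\<^sub>v x)) $ i = egf (\<lambda>k. ((1\<^sub>m n * A ^\<^sub>m Suc k) *\<^sub>v x) $ i) t"
    using output_mat_exp[OF A A x i, of t]
    unfolding assoc_mult_mat_vec[OF A E x] pow_mat_Suc_left[OF A]
      left_mult_one_mat[OF mult_carrier_mat[OF A pow_carrier_mat[OF A]]] .
  ultimately show ?thesis
    using egf_DERIV[OF output_geom_bounded[OF A one_carrier_mat x i], of t] by (simp only:)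
qed

text \<open>Uniqueness for \<open>e' = A e\<close>: the function \<open>s \<mapsto> mat_exp ((T - s) A) e(s)\<close> has zero derivative.\<close>

lemma linear_ode_unique:
  fixes e :: "real \<Rightarrow> real vec"
  assumes A: "A \<in> carrier_mat n n" and T: "0 \<le> T" and E: "countable E"
    and e: "\<And>t. t \<in> {0..T} \<Longrightarrow> e t \<in> carrier_vec n"
    and cont: "\<And>i. i < n \<Longrightarrow> continuous_on {0..T} (\<lambda>t. e t $ i)"
    and deriv: "\<And>t i. t \<in> {0<..<T} - E \<Longrightarrow> i < n \<Longrightarrow>
      ((\<lambda>t. e t $ i) has_real_derivative (A *\<^sub>v e t) $ i) (at t)"
  shows "e T = mat_exp (T \<cdot>\<^sub>m A) *\<^sub>v e 0"
proof (rule eq_vecI)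
  note X = mat_exp_carrier[OF A]
  fix i assume "i < dim_vec (mat_exp (T \<cdot>\<^sub>m A) *\<^sub>v e 0)"
  then have i: "i < n" using carrier_matD(1)[OF X] by simp
  define w where "w s = (\<Sum>j<n. mat_exp ((T - s) \<cdot>\<^sub>m A) $$ (i, j) * e s $ j)" for s
  have D: "((\<lambda>s. mat_exp ((T - s) \<cdot>\<^sub>m A) $$ (i, j)) has_real_derivative
      - (\<Sum>l<n. A $$ (l, j) * mat_exp ((T - s) \<cdot>\<^sub>m A) $$ (i, l))) (at s)" if "j < n" for j s
  proof -
    have "((\<lambda>s. T - s) has_real_derivative - 1) (at s)" by (auto intro!: derivative_eq_intros)
    from DERIV_chain2[OF mat_exp_index_DERIV[OF A i that] this] show ?thesis by simp
  qed
  have "w T = w 0"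
  proof (rule DERIV_zero_countable_const[OF T _ E])
    show "continuous_on {0..T} w"
      unfolding w_def
    proof (intro continuous_on_sum continuous_on_mult cont)
      fix j assume "j \<in> {..<n}"
      then show "continuous_on {0..T} (\<lambda>s. mat_exp ((T - s) \<cdot>\<^sub>m A) $$ (i, j))"
        by (intro continuous_at_imp_continuous_on ballI DERIV_isCont[OF D]) simp
    qed simp
    fix s assume s: "s \<in> {0<..<T} - E"
    define M where "M = mat_exp ((T - s) \<cdot>\<^sub>m A)"
    have es: "e s \<in> carrier_vec n" using e s by simp
    have "(w has_real_derivative (\<Sum>j<n. - (\<Sum>l<n. A $$ (l, j) * M $$ (i, l)) * e s $ j
        + (A *\<^sub>v e s) $ j * M $$ (i, j))) (at s)"
      unfolding w_def M_def by (intro DERIV_sum DERIV_mult D deriv[OF s]) simp_all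
    \<comment> \<open>Differentiating the exponential and differentiating the state yield the same
      double sum with opposite signs.\<close>
    moreover have "(\<Sum>j<n. - (\<Sum>l<n. A $$ (l, j) * M $$ (i, l)) * e s $ j + (A *\<^sub>v e s) $ j * M $$ (i, j)) = 0"
    proof -
      have "(\<Sum>j<n. (A *\<^sub>v e s) $ j * M $$ (i, j)) = (\<Sum>j<n. \<Sum>l<n. A $$ (j, l) * e s $ l * M $$ (i, j))"
        by (rule sum.cong) (simp_all add: index_mult_mat_vec_sum[OF A es] sum_distrib_right)
      also have "\<dots> = (\<Sum>l<n. \<Sum>j<n. A $$ (j, l) * e s $ l * M $$ (i, j))" by (rule sum.swap)
      also have "\<dots> = (\<Sum>j<n. (\<Sum>l<n. A $$ (l, j) * M $$ (i, l)) * e s $ j)"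
        by (simp add: sum_distrib_left sum_distrib_right mult_ac)
      finally show ?thesis by (simp add: sum.distrib sum_negf sum_subtractf)
    qed
    ultimately show "(w has_real_derivative 0) (at s)" by simp
  qed
  moreover have "w T = (mat_exp (0 \<cdot>\<^sub>m A) *\<^sub>v e T) $ i"
    using index_mult_mat_vec_sum[OF X e i, of T] T by (simp add: w_def)
  moreover have "w 0 = (mat_exp (T \<cdot>\<^sub>m A) *\<^sub>v e 0) $ i"
    using index_mult_mat_vec_sum[OF X e i, of 0] T by (simp add: w_def)
  ultimately show "e T $ i = (mat_exp (T \<cdot>\<^sub>m A) *\<^sub>v e 0) $ i"
    using mat_exp_0_mult_vec[OF A e[of T]] T by simp
qed (use e[of T] T mat_exp_carrier[OF A, of T] in simp)

text \<open>An output of the free motion that vanishes on an interval of positive length has only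
  zero coefficients, so any positive horizon serves for necessity. For sufficiency, the difference
  of two states solves the homogeneous equation off a countable set and is thus given by the
  exponential.\<close>

lemma ct_observable_iff:
  assumes A: "A \<in> carrier_mat n n" and B: "B \<in> carrier_mat n m"
    and C: "C \<in> carrier_mat q n" and D: "D \<in> carrier_mat q m" and F: "F \<in> carrier_mat r n"
    and nonneg: "\<And>t. t \<in> set ts \<Longrightarrow> 0 \<le> t"
  shows "ct_sb_functionally_observable A B C D F ts \<longleftrightarrow>
    (\<forall>x\<in>carrier_vec n. (\<forall>t\<in>set ts. (C * mat_exp (t \<cdot>\<^sub>m A)) *\<^sub>v x = 0\<^sub>v q) \<longrightarrow>
      (\<forall>k. (F * A ^\<^sub>m k) *\<^sub>v x = 0\<^sub>v r))" (is "_ \<longleftrightarrow> ?kernel")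
proof
  assume "ct_sb_functionally_observable A B C D F ts"
  then obtain tb where tb: "tb > 0"
    and "reconstructible (ct_trajectory A B) n C D F ts tb"
    unfolding ct_sb_functionally_observable_def carrier_matD(1)[OF A] by blast
  note unique = this(2)[unfolded reconstructible_iff, rule_format]
  show ?kernel
  proof (intro ballI impI allI)
    fix x k assume x: "x \<in> carrier_vec n"
      and y0: "\<forall>t\<in>set ts. (C * mat_exp (t \<cdot>\<^sub>m A)) *\<^sub>v x = 0\<^sub>v q"
    define X where "X t = mat_exp (t \<cdot>\<^sub>m A) *\<^sub>v x" for t
    have X0: "X 0 = x" unfolding X_def by (rule mat_exp_0_mult_vec[OF A x])
    have X: "X t \<in> carrier_vec n" for t
      unfolding X_def by (rule mult_mat_vec_carrier[OF mat_exp_carrier[OF A] x])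
    have XD: "((\<lambda>t. X t $ i) has_real_derivative (A *\<^sub>v X t) $ i) (at t)" if "i < n" for i t
      unfolding X_def by (rule mat_exp_mult_vec_DERIV[OF A x that])
    have zero: "A *\<^sub>v v + B *\<^sub>v 0\<^sub>v m = A *\<^sub>v v" if "v \<in> carrier_vec n" for v
      unfolding mult_mat_zero_vec[OF B] by (rule right_zero_vec[OF mult_mat_vec_carrier[OF A that]])
    have "ct_trajectory A B x (\<lambda>_. 0\<^sub>v m) X"
      unfolding ct_trajectory_def carrier_matD(1)[OF A] carrier_matD(2)[OF B] zero[OF X]
      using X0 X by (auto intro!: exI[of _ "{}"] continuous_at_imp_continuous_on DERIV_isCont[OF XD]
        has_field_derivative_at_within[OF XD])
    moreover have "ct_trajectory A B (0\<^sub>v n) (\<lambda>_. 0\<^sub>v m) (\<lambda>_. 0\<^sub>v n)"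
      unfolding ct_trajectory_def carrier_matD(1)[OF A] carrier_matD(2)[OF B]
        zero[OF zero_carrier_vec, unfolded mult_mat_zero_vec[OF A]] mult_mat_zero_vec[OF A]
      by (auto intro!: exI[of _ "{}"])
    moreover have "C *\<^sub>v X s + D *\<^sub>v 0\<^sub>v m = C *\<^sub>v 0\<^sub>v n + D *\<^sub>v 0\<^sub>v m" if "s \<in> set ts" for s
      unfolding X_def assoc_mult_mat_vec[OF C mat_exp_carrier[OF A] x, symmetric] mult_mat_zero_vec[OF C]
      using y0 that by simp
    ultimately have "F *\<^sub>v X t = F *\<^sub>v 0\<^sub>v n" if "t \<in> {0..tb}" for t
      using unique[OF x zero_carrier_vec _ _ _ _ that] by blast
    then have FX: "(F * mat_exp (t \<cdot>\<^sub>m A)) *\<^sub>v x = 0\<^sub>v r" if "t \<in> {0..tb}" for t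
      using that unfolding X_def assoc_mult_mat_vec[OF F mat_exp_carrier[OF A] x] mult_mat_zero_vec[OF F] .
    show "(F * A ^\<^sub>m k) *\<^sub>v x = 0\<^sub>v r"
    proof (rule eq_vecI)
      fix a assume "a < dim_vec (0\<^sub>v r :: real vec)"
      then have a: "a < r" by simp
      show "((F * A ^\<^sub>m k) *\<^sub>v x) $ a = 0\<^sub>v r $ a"
        using egf_eq_zero_imp[OF output_geom_bounded[OF A F x a] tb] FX a
        by (simp add: output_mat_exp[OF A F x a, symmetric])
    qed (use F in simp)
  qed
next
  assume kernel: ?kernel
  \<comment> \<open>Beyond all samples, so that the inputs entering them cancel; the summand 1 makes
    the horizon positive even if 0 is the only sampling time.\<close>
  define tb where "tb = Max (insert 0 (set ts)) + 1"
  have ts: "t \<in> {0..tb}" if "t \<in> set ts" for t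
  proof -
    have "t \<le> Max (insert 0 (set ts))" using that by (intro Max_ge) auto
    then show ?thesis unfolding tb_def using nonneg[OF that] by simp
  qed
  have "0 \<le> Max (insert 0 (set ts))" by (intro Max_ge) auto
  then have tb0: "tb > 0" unfolding tb_def by linarith
  have "reconstructible (ct_trajectory A B) n C D F ts tb"
    unfolding reconstructible_iff
  proof (intro ballI allI impI)
    fix x0 x0' u x u' x' t
    assume traj: "ct_trajectory A B x0 u x" "ct_trajectory A B x0' u' x'"
      and u: "\<forall>t\<in>{0..tb}. u t = u' t"
      and y: "\<forall>s\<in>set ts. C *\<^sub>v x s + D *\<^sub>v u s = C *\<^sub>v x' s + D *\<^sub>v u' s"
      and t: "t \<in> {0..tb}"
    note traj = traj[unfolded ct_trajectory_def carrier_matD(1)[OF A] carrier_matD(2)[OF B],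
        THEN conjunct2]
    note bounds = traj[THEN conjunct1, rule_format] and traj = traj[THEN conjunct2]
    note cont = traj[THEN conjunct1, rule_format] and traj = traj[THEN conjunct2]
    have x: "x t \<in> carrier_vec n" "x' t \<in> carrier_vec n" and uc: "u t \<in> carrier_vec m"
      if "0 \<le> t" for t using bounds[OF that] by simp_all
    obtain E where E: "countable E"
      and xD: "\<forall>t\<in>{0..} - E. \<forall>i<n. ((\<lambda>s. x s $ i) has_real_derivative
        (A *\<^sub>v x t + B *\<^sub>v u t) $ i) (at t within {0..})"
      using traj(1) by (elim exE conjE)
    obtain E' where E': "countable E'"
      and xD': "\<forall>t\<in>{0..} - E'. \<forall>i<n. ((\<lambda>s. x' s $ i) has_real_derivative
        (A *\<^sub>v x' t + B *\<^sub>v u' t) $ i) (at t within {0..})"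
      using traj(2) by (elim exE conjE)
    define e where "e t = x t - x' t" for t
    have e: "e t \<in> carrier_vec n" if "0 \<le> t" for t unfolding e_def using x[OF that] by simp
    have ei: "e t $ i = x t $ i - x' t $ i" if "0 \<le> t" "i < n" for t i
      unfolding e_def using x[OF that(1)] that(2) by simp
    \<comment> \<open>Uniqueness is applied on each interval from 0 to \<open>s\<close>, where the
      inputs agree, with the union of both exceptional sets.\<close>
    have eX: "e s = mat_exp (s \<cdot>\<^sub>m A) *\<^sub>v e 0" if s: "s \<in> {0..tb}" for s
    proof (rule linear_ode_unique[OF A])
      show "0 \<le> s" "countable (E \<union> E')" using s E E' by auto
      show "e t \<in> carrier_vec n" if "t \<in> {0..s}" for t using e that by simp
      show "continuous_on {0..s} (\<lambda>t. e t $ i)" if "i < n" for i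
      proof -
        have "continuous_on {0..s} (\<lambda>t. x t $ i - x' t $ i)"
          by (intro continuous_on_diff continuous_on_subset[OF cont(1)[OF that]]
              continuous_on_subset[OF cont(2)[OF that]]) auto
        moreover have "continuous_on {0..s} (\<lambda>t. e t $ i) \<longleftrightarrow>
            continuous_on {0..s} (\<lambda>t. x t $ i - x' t $ i)"
          by (rule continuous_on_cong) (use ei that in simp_all)
        ultimately show ?thesis by simp
      qed
      show "((\<lambda>t. e t $ i) has_real_derivative (A *\<^sub>v e t) $ i) (at t)"
        if t: "t \<in> {0<..<s} - (E \<union> E')" and i: "i < n" for t i
      proof -
        have t0: "0 \<le> t" using t by simp
        have "u' t = u t" using u s t by simp
        then have "((\<lambda>s. x s $ i - x' s $ i) has_real_derivative
            (A *\<^sub>v x t + B *\<^sub>v u t) $ i - (A *\<^sub>v x' t + B *\<^sub>v u t) $ i) (at t within {0..})"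
          using DERIV_diff[OF xD[rule_format, of t i] xD'[rule_format, of t i]] t i by simp
        also have "(A *\<^sub>v x t + B *\<^sub>v u t) $ i - (A *\<^sub>v x' t + B *\<^sub>v u t) $ i = (A *\<^sub>v e t) $ i"
          unfolding e_def mult_minus_distrib_mat_vec[OF A x[OF t0]] using A B i by simp
        finally have "((\<lambda>s. x s $ i - x' s $ i) has_real_derivative (A *\<^sub>v e t) $ i) (at t within {0<..})"
          by (rule DERIV_subset) auto
        \<comment> \<open>At positive times the derivative within the half-line is
          two-sided.\<close>
        then have "((\<lambda>s. x s $ i - x' s $ i) has_real_derivative (A *\<^sub>v e t) $ i) (at t)"
          using at_within_open[of t "{0<..}"] t by simp
        then show ?thesis
          by (rule has_field_derivative_transform_within_open[of _ _ _ "{0<..}"]) (use t i ei in auto)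
      qed
    qed
    have out: "N *\<^sub>v e s = (N * mat_exp (s \<cdot>\<^sub>m A)) *\<^sub>v e 0" if "N \<in> carrier_mat l n" "s \<in> {0..tb}" for N l s
      unfolding assoc_mult_mat_vec[OF that(1) mat_exp_carrier[OF A] e[OF order_refl]]
      by (rule arg_cong[OF eX[OF that(2)]])
    have "(C * mat_exp (s \<cdot>\<^sub>m A)) *\<^sub>v e 0 = 0\<^sub>v q" if s: "s \<in> set ts" for s
    proof -
      note s0 = nonneg[OF s]
      have "u' s = u s" using u ts[OF s] by simp
      then have "C *\<^sub>v x s + D *\<^sub>v u s = C *\<^sub>v x' s + D *\<^sub>v u s" using y s by simp
      then have "C *\<^sub>v x s = C *\<^sub>v x' s"
        using add_right_cancel_vec[OF mult_mat_vec_carrier[OF C x(1)[OF s0]]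
            mult_mat_vec_carrier[OF C x(2)[OF s0]] mult_mat_vec_carrier[OF D uc[OF s0]]] by blast
      then show ?thesis
        using out[OF C ts[OF s]] mult_mat_vec_eq_iff[OF C x[OF s0]] unfolding e_def by metis
    qed
    then have F0: "(F * A ^\<^sub>m k) *\<^sub>v e 0 = 0\<^sub>v r" for k using kernel e[OF order_refl] by blast
    have "(F * mat_exp (t \<cdot>\<^sub>m A)) *\<^sub>v e 0 = 0\<^sub>v r"
    proof (rule eq_vecI)
      fix a assume "a < dim_vec (0\<^sub>v r :: real vec)"
      then have a: "a < r" by simp
      show "((F * mat_exp (t \<cdot>\<^sub>m A)) *\<^sub>v e 0) $ a = 0\<^sub>v r $ a"
        unfolding output_mat_exp[OF A F e[OF order_refl] a] F0 using a by (simp add: egf_def)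
    qed (use F in simp)
    then have "F *\<^sub>v (x t - x' t) = 0\<^sub>v r" using out[OF F t] unfolding e_def by simp
    then show "F *\<^sub>v x t = F *\<^sub>v x' t"
      using mult_mat_vec_eq_iff[OF F x] t by simp
  qed
  then show "ct_sb_functionally_observable A B C D F ts"
    unfolding ct_sb_functionally_observable_def carrier_matD(1)[OF A] using tb0 by blast
qed

theorem theorem2:
  fixes A B C D F :: "real mat" and n m q r :: nat
    and tc :: "real list" and td :: "nat list"
  assumes "A \<in> carrier_mat n n" and "B \<in> carrier_mat n m"
    and "C \<in> carrier_mat q n" and "D \<in> carrier_mat q m"
    and "F \<in> carrier_mat r n"
  shows "(sampling_sequence tc \<longrightarrow>
           (ct_sb_functionally_observable A B C D F tc \<longleftrightarrow>
            mat_rank (ct_sample_obs_mat A C tc @\<^sub>r obs_mat A F)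
              = mat_rank (ct_sample_obs_mat A C tc))) \<and>
         (sampling_sequence td \<longrightarrow>
           (dt_sb_functionally_observable A B C D F td \<longleftrightarrow>
            mat_rank (dt_sample_obs_mat A C td @\<^sub>r obs_mat A F)
              = mat_rank (dt_sample_obs_mat A C td)))"
proof (intro conjI impI)
  note A = assms(1) and C = assms(3) and F = assms(5)
  assume "sampling_sequence tc"
  \<comment> \<open>The increasing order carries the sign of the first instant over to all
    others.\<close>
  then have "0 \<le> t" if "t \<in> set tc" for t
    using that unfolding sampling_sequence_def by (cases tc) auto
  note ct_observable_iff[OF assms this]
  then show "ct_sb_functionally_observable A B C D F tc \<longleftrightarrow>
      mat_rank (ct_sample_obs_mat A C tc @\<^sub>r obs_mat A F) = mat_rank (ct_sample_obs_mat A C tc)"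
    unfolding ct_sample_obs_mat_def carrier_matD(1)[OF A]
      mat_rank_sample_iff[OF A F mult_carrier_mat[OF C mat_exp_carrier[OF A]]] .
next
  note A = assms(1) and C = assms(3) and F = assms(5)
  show "dt_sb_functionally_observable A B C D F td \<longleftrightarrow>
      mat_rank (dt_sample_obs_mat A C td @\<^sub>r obs_mat A F) = mat_rank (dt_sample_obs_mat A C td)"
    unfolding dt_sample_obs_mat_def carrier_matD(1)[OF A]
      mat_rank_sample_iff[OF A F mult_carrier_mat[OF C pow_carrier_mat[OF A]]]
    by (rule dt_observable_iff[OF assms])
qed

end
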